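(* Let $b,c$ be positive integers with $bc\le 4$, let $\mathcal{B}$ be the canonical basis of $\mathcal{A}(b,c)$, and let $\alpha\mapsto x[\alpha]$ be the bijection $Q=\mathbb{Z}^2\to\mathcal{B}$ described in the context. For every $p\in\mathbb{Z}$, this bijection translates the action of the automorphism $\sigma_p$ on $\mathcal{B}$ into a piecewise linear transformation of $Q$. In particular, the action of $\sigma_1$ and $\sigma_2$ on $Q$ (defined by $x[\sigma_p(\alpha)]=\sigma_p(x[\alpha])$) is given by $$\sigma_1(a_1,a_2)=(a_1,\;c\max(a_1,0)-a_2),\qquad \sigma_2(a_1,a_2)=(b\max(a_2,0)-a_1,\;a_2).$$
   Context: Let $\mathcal{F}=\mathbb{Q}(y_1,y_2)$ be the field of rational functions in two commuting independent variables. For positive integers $b,c$ define $y_m\in\mathcal{F}$ for all $m\in\mathbb{Z}$ recursively by $y_{m-1}y_{m+1}=y_m^b+1$ for $m$ odd and $y_{m-1}y_{m+1}=y_m^c+1$ for $m$ even. The cluster algebra $\mathcal{A}(b,c)$ is the subring of $\mathcal{F}$ generated by all $y_m$, $m\in\mathbb{Z}$. It is known (Laurent phenomenon) that for each $m\in\mathbb{Z}$ every element of $\mathcal{A}(b,c)$ is uniquely a Laurent polynomial with integer coefficients in $y_m$ and $y_{m+1}$. A non-zero element $y\in\mathcal{A}(b,c)$ is called positive if for every $m\in\mathbb{Z}$ all the (non-zero) coefficients in the expansion of $y$ as a Laurent polynomial in $y_m$ and $y_{m+1}$ are positive. When $bc\le 4$, the canonical basis $\mathcal{B}$ is the unique $\mathbb{Z}$-basis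 of $\mathcal{A}(b,c)$ such that the set of positive elements consists precisely of the positive integer linear combinations of elements of $\mathcal{B}$ (existence and uniqueness is a theorem of the same paper). Also by a theorem of the same paper, for $bc\le4$ and every $\alpha=(a_1,a_2)\in Q=\mathbb{Z}^2$ there is a unique element $x[\alpha]\in\mathcal{B}$ of the form $N_\alpha(y_1,y_2)/(y_1^{a_1}y_2^{a_2})$ with $N_\alpha$ a polynomial with constant term $1$, and $\alpha\mapsto x[\alpha]$ is a bijection $Q\to\mathcal{B}$. For $p\in\mathbb{Z}$, $\sigma_p$ is the ring automorphism of $\mathcal{A}(b,c)$ acting on cluster variables by $\sigma_p(y_m)=y_{2p-m}$ for all $m\in\mathbb{Z}$; it exists by the symmetry of the exchange relations, it preserves the set of positive elements, and hence it permutes $\mathcal{B}$. *)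

theory Defs
  imports
    "HOL-Computational_Algebra.Computational_Algebra"
    "HOL-Library.Poly_Mapping"
begin

(* The field F = Q(y_1, y_2).  In the iterated polynomial ring the inner variable is y_1 and the
   outer one is y_2. *)

type_synonym ratfun2 = "rat poly poly fract"

definition Y1 :: ratfun2 where "Y1 = to_fract [:[:0, 1:]:]"

definition Y2 :: ratfun2 where "Y2 = to_fract [:0, 1:]"

definition exch_exponent :: "nat \<Rightarrow> nat \<Rightarrow> int \<Rightarrow> nat" where
  "exch_exponent b c m = (if odd m then b else c)"

(* cluster_up n = y_(n+1) and cluster_down n = y_(2-n), obtained by solving the exchange relation
   for y_(m+1) and for y_(m-1), respectively.  See exchange_relation below. *)

fun cluster_up :: "nat \<Rightarrow> nat \<Rightarrow> nat \<Rightarrow> ratfun2" where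
  "cluster_up b c 0 = Y1"
| "cluster_up b c (Suc 0) = Y2"
| "cluster_up b c (Suc (Suc n)) =
     (cluster_up b c (Suc n) ^ exch_exponent b c (int n + 2) + 1) / cluster_up b c n"

fun cluster_down :: "nat \<Rightarrow> nat \<Rightarrow> nat \<Rightarrow> ratfun2" where
  "cluster_down b c 0 = Y2"
| "cluster_down b c (Suc 0) = Y1"
| "cluster_down b c (Suc (Suc n)) =
     (cluster_down b c (Suc n) ^ exch_exponent b c (1 - int n) + 1) / cluster_down b c n"

definition cluster_var :: "nat \<Rightarrow> nat \<Rightarrow> int \<Rightarrow> ratfun2" where
  "cluster_var b c m =
     (if m \<ge> 1 then cluster_up b c (nat (m - 1)) else cluster_down b c (nat (2 - m)))"

inductive_set subring_generated :: "'a::ring_1 set \<Rightarrow> 'a set" for X where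
  base: "u \<in> X \<Longrightarrow> u \<in> subring_generated X"
| one: "1 \<in> subring_generated X"
| diff: "u \<in> subring_generated X \<Longrightarrow> v \<in> subring_generated X \<Longrightarrow> u - v \<in> subring_generated X"
| mult: "u \<in> subring_generated X \<Longrightarrow> v \<in> subring_generated X \<Longrightarrow> u * v \<in> subring_generated X"

definition cluster_algebra :: "nat \<Rightarrow> nat \<Rightarrow> ratfun2 set" where
  "cluster_algebra b c = subring_generated (range (cluster_var b c))"

(* Integer Laurent polynomials in two variables are finitely supported coefficient functions on
   the exponent pairs; laurent_eval u v substitutes u, v for the variables. *)

definition laurent_eval ::
    "'a::field \<Rightarrow> 'a \<Rightarrow> ((int \<times> int) \<Rightarrow>\<^sub>0 int) \<Rightarrow> 'a" where
  "laurent_eval u v f =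
     (\<Sum>(i, j)\<in>Poly_Mapping.keys f.
        of_int (Poly_Mapping.lookup f (i, j)) * (u powi i * v powi j))"

(* By the Laurent phenomenon, every element of the cluster algebra has exactly one integer Laurent
   expansion f for each m, so the existential quantifier refers to the expansion. *)

definition positive_element :: "nat \<Rightarrow> nat \<Rightarrow> ratfun2 \<Rightarrow> bool" where
  "positive_element b c z \<longleftrightarrow>
     z \<in> cluster_algebra b c \<and> z \<noteq> 0 \<and>
     (\<forall>m. \<exists>f. z = laurent_eval (cluster_var b c m) (cluster_var b c (m + 1)) f \<and>
              (\<forall>k\<in>Poly_Mapping.keys f. Poly_Mapping.lookup f k > 0))"

definition int_scale :: "int \<Rightarrow> 'a::ring_1 \<Rightarrow> 'a" where
  "int_scale n z = of_int n * z"

definition Z_basis :: "'a::ring_1 set \<Rightarrow> 'a set \<Rightarrow> bool" where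
  "Z_basis A B \<longleftrightarrow> \<not> module.dependent int_scale B \<and> module.span int_scale B = A"

definition positive_combinations :: "'a::ring_1 set \<Rightarrow> 'a set" where
  "positive_combinations B =
     {(\<Sum>z\<in>S. of_int (n z) * z) | S (n :: 'a \<Rightarrow> int).
        finite S \<and> S \<noteq> {} \<and> S \<subseteq> B \<and> (\<forall>z\<in>S. n z > 0)}"

definition is_canonical_basis :: "nat \<Rightarrow> nat \<Rightarrow> ratfun2 set \<Rightarrow> bool" where
  "is_canonical_basis b c B \<longleftrightarrow>
     Z_basis (cluster_algebra b c) B \<and>
     {z. positive_element b c z} = positive_combinations B"

(* z = N(y_1, y_2) / (y_1^a_1 y_2^a_2) with N a polynomial of constant term 1 *)

definition has_denominator_vector :: "ratfun2 \<Rightarrow> int \<times> int \<Rightarrow> bool" where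
  "has_denominator_vector z \<alpha> \<longleftrightarrow>
     (\<exists>N :: rat poly poly. coeff (coeff N 0) 0 = 1 \<and>
        z = to_fract N / (Y1 powi fst \<alpha> * Y2 powi snd \<alpha>))"

(* x is the map sending alpha to the unique element x[alpha] of B with denominator vector alpha,
   and it is a bijection onto B. *)

definition is_denominator_parametrization ::
    "ratfun2 set \<Rightarrow> (int \<times> int \<Rightarrow> ratfun2) \<Rightarrow> bool" where
  "is_denominator_parametrization B x \<longleftrightarrow>
     (\<forall>\<alpha> z. (z \<in> B \<and> has_denominator_vector z \<alpha>) \<longleftrightarrow> z = x \<alpha>) \<and> bij_betw x UNIV B"

(* Only the values of f on the subring A matter. *)

definition ring_automorphism_on :: "'a::ring_1 set \<Rightarrow> ('a \<Rightarrow> 'a) \<Rightarrow> bool" where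
  "ring_automorphism_on A f \<longleftrightarrow>
     bij_betw f A A \<and> f 1 = 1 \<and>
     (\<forall>u\<in>A. \<forall>v\<in>A. f (u + v) = f u + f v \<and> f (u * v) = f u * f v)"

(* The lattice is covered by finitely many rational polyhedral cones (each cut out by finitely
   many integral linear inequalities h_1 a_1 + h_2 a_2 >= 0), on each of which g is linear.
   The cones are closed and may overlap, so g extends to a continuous piecewise linear map of
   the real plane. *)

definition rational_cone :: "(int \<times> int) set \<Rightarrow> (int \<times> int) set" where
  "rational_cone H = {(a1, a2). \<forall>(h1, h2)\<in>H. 0 \<le> h1 * a1 + h2 * a2}"

definition piecewise_linear :: "(int \<times> int \<Rightarrow> int \<times> int) \<Rightarrow> bool" where
  "piecewise_linear g \<longleftrightarrow>
     (\<exists>\<H>. finite \<H> \<and> (\<forall>H\<in>\<H>. finite H) \<and> (\<Union>H\<in>\<H>. rational_cone H) = UNIV \<and>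
        (\<forall>H\<in>\<H>. \<exists>p q r s. \<forall>(a1, a2)\<in>rational_cone H.
           g (a1, a2) = (p * a1 + q * a2, r * a1 + s * a2)))"

lemma module_int_scale: "module (int_scale :: int \<Rightarrow> 'a::ring_1 \<Rightarrow> 'a)"
  by standard (simp_all add: int_scale_def algebra_simps)

lemma Y1_pos: "Y1 > 0" and Y2_pos: "Y2 > 0"
  by (simp_all add: Y1_def Y2_def to_fract_def zero_less_Fract_iff less_poly_def pos_poly_def)

lemma cluster_up_pos: "cluster_up b c n > 0"
  by (induction b c n rule: cluster_up.induct) (auto simp: Y1_pos Y2_pos add_pos_pos)

lemma cluster_down_pos: "cluster_down b c n > 0"
  by (induction b c n rule: cluster_down.induct) (auto simp: Y1_pos Y2_pos add_pos_pos)

lemma cluster_var_1: "cluster_var b c 1 = Y1" and cluster_var_2: "cluster_var b c 2 = Y2"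
  by (simp_all add: cluster_var_def)

lemma cluster_var_down: "m \<le> 2 \<Longrightarrow> cluster_var b c m = cluster_down b c (nat (2 - m))"
proof -
  assume "m \<le> 2"
  then consider "m = 2" | "m = 1" | "m < 1" by linarith
  then show ?thesis by cases (simp_all add: cluster_var_def)
qed

lemma exchange_relation:
  "cluster_var b c (m - 1) * cluster_var b c (m + 1) =
     cluster_var b c m ^ (if odd m then b else c) + 1"
proof (cases "m \<ge> 2")
  case True
  define n where "n = nat (m - 2)"
  have m: "m = int n + 2" using True by (simp add: n_def)
  have "cluster_var b c (m - 1) = cluster_up b c n"
    "cluster_var b c m = cluster_up b c (Suc n)"
    "cluster_var b c (m + 1) = cluster_up b c (Suc (Suc n))"
    by (simp_all add: m cluster_var_def nat_add_distrib del: cluster_up.simps)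
  then show ?thesis using cluster_up_pos[of b c n] by (simp add: m exch_exponent_def)
next
  case False
  define n where "n = nat (1 - m)"
  have m: "m = 1 - int n" using False by (simp add: n_def)
  have "cluster_var b c (m - 1) = cluster_down b c (Suc (Suc n))"
    "cluster_var b c m = cluster_down b c (Suc n)"
    "cluster_var b c (m + 1) = cluster_down b c n"
    by (simp_all add: m cluster_var_down nat_add_distrib Suc_nat_eq_nat_zadd1 del: cluster_down.simps)
  then show ?thesis using cluster_down_pos[of b c n] by (simp add: m exch_exponent_def)
qed

end

theory Submission
  imports Defs
begin

text \<open>
  The elements of the canonical basis are the positive elements that are not sums of two positive
  ones, and a reflection \<open>\<sigma>\<^sub>p\<close> is an involution that permutes the clusters; hence it permutes the
  basis (\<open>basis_eq_indecomposable_positive\<close>, \<open>cluster_reflection.positive_reflect\<close>) and induces a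
  bijection of the lattice of denominator vectors. Since conjugating \<open>\<sigma>\<^sub>p\<close> by \<open>\<sigma>\<^sub>r\<close> gives
  \<open>\<sigma>\<close> at \<open>2 r - p\<close>, all these bijections are composites of those for \<open>\<sigma>\<^sub>1\<close> and \<open>\<sigma>\<^sub>2\<close>, and piecewise
  linearity follows from the explicit formulas for these two.

  For \<open>\<sigma>\<^sub>1\<close> let \<open>p\<^sub>\<alpha>(y\<^sub>2)\<close> be the coefficient of the lowest power of \<open>y\<^sub>1\<close>, namely of \<open>y\<^sub>1\<close> to the power
  \<open>- a\<^sub>1\<close>, in the Laurent expansion of \<open>x[\<alpha>]\<close>. Its lowest term is \<open>y\<^sub>2\<close> to the power \<open>- a\<^sub>2\<close> with
  coefficient \<open>1\<close>. The reflection fixes \<open>y\<^sub>1\<close> and replaces \<open>y\<^sub>2\<close> by \<open>y\<^sub>0 = (y\<^sub>1\<^sup>b + 1) / y\<^sub>2\<close>, which is \<open>1 / y\<^sub>2\<close>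
  on \<open>y\<^sub>1 = 0\<close>. So \<open>a\<^sub>1\<close> is unchanged, and the new second coordinate is the degree of \<open>p\<^sub>\<alpha>\<close>, whose top
  coefficient is therefore \<open>1\<close> as well. It remains to see that lowest and highest exponent
  of \<open>p\<^sub>\<alpha>\<close> differ by exactly \<open>c max(a\<^sub>1, 0)\<close>.

  The difference is at least that large because \<open>x[\<alpha>]\<close> is also a Laurent polynomial in \<open>y\<^sub>2\<close> and
  \<open>y\<^sub>3 = (y\<^sub>2\<^sup>c + 1) / y\<^sub>1\<close>, which makes \<open>p\<^sub>\<alpha>\<close> divisible by \<open>(y\<^sub>2\<^sup>c + 1)\<close> to the power \<open>max(a\<^sub>1, 0)\<close>. It is at most
  that large because \<open>\<B>\<close> spans the algebra: the monomial in \<open>y\<^sub>0, y\<^sub>1, y\<^sub>2, y\<^sub>3\<close> with denominator vector \<open>\<alpha>\<close>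
  has a lowest coefficient of exactly this width. Among the basis elements of lowest order in its
  expansion, the polynomials \<open>p\<^sub>\<beta>\<close> have pairwise distinct lowest exponents and, by bijectivity of the
  reflection, pairwise distinct degrees, so neither end of the sum can cancel. Comparing lowest terms shows
  that \<open>x[\<alpha>]\<close> occurs, and comparing highest terms bounds the degree of \<open>p\<^sub>\<alpha>\<close>. This is
  \<open>exchange_chart.reflected_denominator_vector\<close>; the formula for \<open>\<sigma>\<^sub>2\<close> is the same statement with \<open>y\<^sub>1\<close> and
  \<open>y\<^sub>2\<close> interchanged.
\<close>

section \<open>Order and leading coefficient along a divisor\<close>

text \<open>Reduction modulo \<open>t\<close> extends to fractions without a pole along \<open>t = 0\<close>. After division by a
power of \<open>t\<close> it yields an order along \<open>t = 0\<close> and a leading coefficient. The residue field is not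
built: \<open>ev\<close> may be any ring homomorphism into a field that kills \<open>t\<close>.\<close>

locale leading_term =
  fixes ev :: "'p::idom \<Rightarrow> 'k::field" and t :: 'p and U :: "'p fract"
  assumes ev_add: "ev (p + q) = ev p + ev q"
    and ev_mult: "ev (p * q) = ev p * ev q"
    and ev_1: "ev 1 = 1"
    and ev_t: "ev t = 0"
    and t_nz: "t \<noteq> 0"
    and U_def: "U = to_fract t"
begin

text \<open>The value of \<open>P / Q\<close> on \<open>t = 0\<close>. A relation rather than a function, because only fractions with
a representative whose denominator survives \<open>ev\<close> have a value.\<close>

definition residue :: "'p fract \<Rightarrow> 'k \<Rightarrow> bool" where
  "residue z p \<longleftrightarrow> (\<exists>P Q. ev Q \<noteq> 0 \<and> z * to_fract Q = to_fract P \<and> p * ev Q = ev P)"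

text \<open>\<open>lead z k p\<close> says \<open>z = U\<^sup>k (p + \<dots>)\<close>, with higher powers of \<open>U\<close> omitted. The case \<open>p = 0\<close> is included
and means that the order of \<open>z\<close> exceeds \<open>k\<close>; this makes \<open>lead\<close> additive even when leading terms
cancel.\<close>

definition lead :: "'p fract \<Rightarrow> int \<Rightarrow> 'k \<Rightarrow> bool" where
  "lead z k p \<longleftrightarrow> residue (z / U powi k) p"

lemma U_nz: "U \<noteq> 0"
  by (simp add: U_def t_nz)

lemma ev_0: "ev 0 = 0"
  using ev_add[of 0 0] by (metis add_0 add_cancel_right_right)

lemma ev_uminus: "ev (- p) = - ev p"
  using ev_add[of p "- p"] by (simp add: ev_0 eq_neg_iff_add_eq_0 add.commute)

lemma residue_to_fract: "residue (to_fract P) (ev P)"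
  unfolding residue_def by (rule exI[of _ P], rule exI[of _ 1]) (simp add: ev_1)

lemma residue_unique:
  assumes "residue z p" "residue z q" shows "p = q"
proof -
  obtain P Q where 1: "ev Q \<noteq> 0" "z * to_fract Q = to_fract P" "p * ev Q = ev P"
    using assms(1) by (auto simp: residue_def)
  obtain P' Q' where 2: "ev Q' \<noteq> 0" "z * to_fract Q' = to_fract P'" "q * ev Q' = ev P'"
    using assms(2) by (auto simp: residue_def)
  have "to_fract (P * Q') = to_fract (P' * Q)"
    unfolding to_fract_mult 1(2)[symmetric] 2(2)[symmetric] by (simp add: mult_ac)
  then have "ev (P * Q') = ev (P' * Q)" by (simp only: to_fract_eq_iff)
  then have "(p * ev Q) * ev Q' = (q * ev Q') * ev Q" by (simp add: ev_mult 1(3) 2(3))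
  then show ?thesis using 1(1) 2(1) by simp
qed

lemma residue_add:
  assumes "residue z p" "residue w q" shows "residue (z + w) (p + q)"
proof -
  obtain P Q where 1: "ev Q \<noteq> 0" "z * to_fract Q = to_fract P" "p * ev Q = ev P"
    using assms(1) by (auto simp: residue_def)
  obtain P' Q' where 2: "ev Q' \<noteq> 0" "w * to_fract Q' = to_fract P'" "q * ev Q' = ev P'"
    using assms(2) by (auto simp: residue_def)
  show ?thesis unfolding residue_def
    by (rule exI[of _ "P * Q' + P' * Q"], rule exI[of _ "Q * Q'"])
      (use 1(1) 2(1) in \<open>auto simp: ev_mult ev_add 1(2,3)[symmetric] 2(2,3)[symmetric] algebra_simps\<close>)
qed

lemma residue_mult:
  assumes "residue z p" "residue w q" shows "residue (z * w) (p * q)"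
proof -
  obtain P Q where 1: "ev Q \<noteq> 0" "z * to_fract Q = to_fract P" "p * ev Q = ev P"
    using assms(1) by (auto simp: residue_def)
  obtain P' Q' where 2: "ev Q' \<noteq> 0" "w * to_fract Q' = to_fract P'" "q * ev Q' = ev P'"
    using assms(2) by (auto simp: residue_def)
  show ?thesis unfolding residue_def
    by (rule exI[of _ "P * P'"], rule exI[of _ "Q * Q'"])
      (use 1(1) 2(1) in \<open>auto simp: ev_mult ev_add 1(2,3)[symmetric] 2(2,3)[symmetric] algebra_simps\<close>)
qed

lemma residue_inverse:
  assumes "residue z p" "p \<noteq> 0" shows "residue (inverse z) (inverse p)"
proof -
  obtain P Q where 1: "ev Q \<noteq> 0" "z * to_fract Q = to_fract P" "p * ev Q = ev P"
    using assms(1) by (auto simp: residue_def)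
  have "ev P \<noteq> 0" using 1 assms(2) by (metis mult_eq_0_iff)
  moreover from this have "P \<noteq> 0" using ev_0 by auto
  then have "z \<noteq> 0" using 1(2) by (metis mult_zero_left to_fract_eq_0_iff)
  ultimately show ?thesis unfolding residue_def using assms(2)
    by (intro exI[of _ Q] exI[of _ P]) (auto simp: 1(2,3)[symmetric])
qed

lemma lead_unique: "lead z k p \<Longrightarrow> lead z k q \<Longrightarrow> p = q"
  unfolding lead_def by (rule residue_unique)

lemma lead_add: "lead z k p \<Longrightarrow> lead w k q \<Longrightarrow> lead (z + w) k (p + q)"
  unfolding lead_def add_divide_distrib by (rule residue_add)

lemma lead_mult: "lead z k p \<Longrightarrow> lead w l q \<Longrightarrow> lead (z * w) (k + l) (p * q)"
  unfolding lead_def using U_nz residue_mult[of "z / U powi k" p "w / U powi l" q]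
  by (simp add: power_int_add)

lemma lead_to_fract: "lead (to_fract P) 0 (ev P)"
  by (simp add: lead_def residue_to_fract)

lemma lead_1: "lead 1 0 1"
  using lead_to_fract[of 1] by (simp add: ev_1)

lemma lead_0: "lead 0 k 0"
  using residue_to_fract[of 0] by (simp add: lead_def ev_0)

lemma lead_U: "lead U 1 1"
  using residue_to_fract[of 1] U_nz by (simp add: lead_def ev_1)

lemma lead_inverse: "lead z k p \<Longrightarrow> p \<noteq> 0 \<Longrightarrow> lead (inverse z) (- k) (inverse p)"
  unfolding lead_def using residue_inverse[of "z / U powi k" p]
  by (simp add: power_int_minus field_simps)

lemma lead_power: "lead z k p \<Longrightarrow> lead (z ^ n) (int n * k) (p ^ n)"
proof (induction n)
  case (Suc n)
  then show ?case using lead_mult[of z k p "z ^ n" "int n * k" "p ^ n"] by (simp add: algebra_simps)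
qed (simp add: lead_1)

lemma lead_powi: "lead z k p \<Longrightarrow> p \<noteq> 0 \<Longrightarrow> lead (z powi n) (n * k) (p powi n)"
  using lead_power[of z k p "nat n"] lead_power[of "inverse z" "-k" "inverse p" "nat (-n)"] lead_inverse[of z k p]
  by (auto simp: power_int_def)

lemma lead_of_int: "lead (of_int n) 0 (of_int n)"
proof -
  have nat: "lead (of_nat m) 0 (of_nat m)" for m
    by (induction m) (use lead_0 lead_1 in \<open>auto intro!: lead_add\<close>)
  have m1: "lead (- 1) 0 (- 1)" using lead_to_fract[of "- 1"] by (simp add: ev_uminus ev_1)
  show ?thesis
  proof (cases n)
    case (neg m)
    show ?thesis using lead_mult[OF m1 nat[of "Suc m"]] by (simp add: neg del: of_nat_Suc)
  qed (simp add: nat)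
qed

lemma lead_below: assumes "lead z l p" "k < l" shows "lead z k 0"
proof -
  have "residue U 0" using residue_to_fract[of t] by (simp add: U_def ev_t)
  then have "lead U 0 0" by (simp add: lead_def)
  then have "lead (U ^ nat (l - k)) 0 0"
    using lead_power[of U 0 0 "nat (l - k)"] assms(2) by (simp add: power_0_left)
  from lead_mult[OF assms(1) this] have "residue ((z / U powi l) * U powi (l - k)) 0"
    using assms(2) by (simp add: lead_def power_int_def)
  then show ?thesis using U_nz by (simp add: lead_def power_int_diff)
qed

text \<open>A nonzero leading coefficient determines the order: at any smaller exponent the coefficient is \<open>0\<close>.
Two expansions of one element are always compared through this fact.\<close>

lemma lead_order_unique:
  assumes "lead z k p" "lead z l q" "p \<noteq> 0" "q \<noteq> 0" shows "k = l" "p = q"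
proof -
  show "k = l"
    using assms lead_below lead_unique by (metis linorder_neqE)
  then show "p = q" using assms lead_unique by blast
qed

text \<open>Only the summands of the least order contribute to the leading coefficient of a sum.\<close>

lemma lead_sum:
  assumes "finite S" "\<And>s. s \<in> S \<Longrightarrow> lead (z s) (d s) (p s)" "\<And>s. s \<in> S \<Longrightarrow> k \<le> d s"
  shows "lead (\<Sum>s\<in>S. z s) k (\<Sum>s\<in>{s\<in>S. d s = k}. p s)"
proof -
  have "lead (\<Sum>s\<in>S. z s) k (\<Sum>s\<in>S. if d s = k then p s else 0)"
    using assms
  proof (induction S)
    case (insert s S)
    have "lead (z s) k (if d s = k then p s else 0)"
      using insert.prems lead_below[of "z s" "d s" "p s" k] by (cases "d s = k") fastforce+
    then show ?case using insert by (simp add: lead_add)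
  qed (simp add: lead_0)
  then show ?thesis using assms(1) by (simp add: sum.If_cases Int_def)
qed

end

section \<open>Widths of Laurent polynomials in one variable\<close>

lemma fls_nth_of_int_mult: "fls_nth (of_int n * p) k = (of_int n * fls_nth p k :: 'a::ring_1)"
  by (simp add: fls_of_int)

lemma one_plus_X_power_nonzero: "0 < c \<Longrightarrow> fls_X ^ c + 1 \<noteq> (0 :: rat fls)"
proof (rule notI)
  assume c_pos: "0 < c"
  assume "fls_X ^ c + 1 = (0 :: rat fls)"
  then have "fls_nth (fls_X ^ c + 1 :: rat fls) 0 = 0" by simp
  then show False using c_pos by simp
qed

text \<open>The top coefficient of a Laurent polynomial is preserved by multiplication with \<open>X\<^sup>c + 1\<close>, and its degree
grows by \<open>c\<close>: the coefficient at \<open>n\<close> of the product is the sum of those at \<open>n\<close> and \<open>n - c\<close>. The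
value \<open>D\<close> is only an upper bound for the degree, so the coefficient there may vanish.\<close>

lemma fls_one_plus_X_power_top:
  fixes H :: "rat fls"
  assumes "0 < c" "\<And>n. n > D \<Longrightarrow> fls_nth H n = 0"
  shows "fls_nth (H * (fls_X ^ c + 1) ^ m) (D + int c * int m) = fls_nth H D \<and>
    (\<forall>n > D + int c * int m. fls_nth (H * (fls_X ^ c + 1) ^ m) n = 0)"
proof -
  have step: "fls_nth (P * (fls_X ^ c + 1)) n = fls_nth P (n - int c) + fls_nth P n"
    for P :: "rat fls" and n
    by (simp add: distrib_left fls_X_power_times_conv_shift)
  show ?thesis
  proof (induction m)
    case 0
    then show ?case using assms(2) by simp
  next
    case (Suc m)
    have eq: "H * (fls_X ^ c + 1) ^ Suc m = (H * (fls_X ^ c + 1) ^ m) * (fls_X ^ c + 1)"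
      by (simp add: mult_ac)
    have gt: "D + int c * int (Suc m) - int c = D + int c * int m"
      "D + int c * int (Suc m) > D + int c * int m"
      using \<open>0 < c\<close> by (auto simp: algebra_simps)
    show ?case unfolding eq step
    proof (intro conjI allI impI)
      show "fls_nth (H * (fls_X ^ c + 1) ^ m) (D + int c * int (Suc m) - int c) +
          fls_nth (H * (fls_X ^ c + 1) ^ m) (D + int c * int (Suc m)) = fls_nth H D"
        using Suc gt by (simp only: gt(1))
      fix n assume "n > D + int c * int (Suc m)"
      then have "n - int c > D + int c * int m" "n > D + int c * int m" using gt by linarith+
      then show "fls_nth (H * (fls_X ^ c + 1) ^ m) (n - int c) +
          fls_nth (H * (fls_X ^ c + 1) ^ m) n = 0" using Suc by auto
    qed
  qed
qed

lemma fls_subdegree_one_plus_X_power: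
  "0 < c \<Longrightarrow> fls_subdegree ((fls_X ^ c + 1) ^ m :: rat fls) = 0"
proof -
  assume "0 < c"
  then have "fls_subdegree (fls_X ^ c + 1 :: rat fls) = 0"
    by (intro fls_subdegree_eqI) auto
  then show ?thesis by (simp add: fls_subdegree_pow)
qed

text \<open>A nonzero Laurent polynomial divisible by \<open>(X\<^sup>c + 1)\<^sup>m\<close> has a support of width at least \<open>c m\<close>.\<close>

lemma fls_one_plus_X_power_support:
  fixes H :: "rat fls"
  assumes fin: "finite {n. fls_nth H n \<noteq> 0}" and "H \<noteq> 0" "0 < c"
  obtains i j where "fls_nth (H * (fls_X ^ c + 1) ^ m) i \<noteq> 0"
    "fls_nth (H * (fls_X ^ c + 1) ^ m) j \<noteq> 0" "i + int c * int m \<le> j"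
proof -
  let ?S = "{n. fls_nth H n \<noteq> 0}"
  define D where "D = Max ?S"
  have ne: "?S \<noteq> {}" using \<open>H \<noteq> 0\<close> by (auto simp: fls_eq_iff)
  have D: "fls_nth H D \<noteq> 0" "\<forall>n > D. fls_nth H n = 0"
    using Max_in[OF fin ne] Max_ge[OF fin] unfolding D_def by fastforce+
  have nz: "fls_X ^ c + 1 \<noteq> (0 :: rat fls)"
    using \<open>0 < c\<close> by (rule one_plus_X_power_nonzero)
  have "fls_nth (H * (fls_X ^ c + 1) ^ m) (fls_subdegree (H * (fls_X ^ c + 1) ^ m)) \<noteq> 0"
    using \<open>H \<noteq> 0\<close> nz by (intro nth_fls_subdegree_nonzero) simp
  moreover have "fls_subdegree (H * (fls_X ^ c + 1) ^ m) = fls_subdegree H"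
    using \<open>H \<noteq> 0\<close> nz fls_subdegree_one_plus_X_power[OF \<open>0 < c\<close>] by (subst fls_subdegree_mult) auto
  moreover have "fls_subdegree H \<le> D" using D(1) by (rule fls_subdegree_leI)
  ultimately show thesis
    using fls_one_plus_X_power_top[OF \<open>0 < c\<close>, of D H m] D by (intro that[of "fls_subdegree H" "D + int c * int m"]) auto
qed

section \<open>Leading terms in a cluster and its neighbours\<close>

text \<open>A cluster \<open>(U, V)\<close> with its two neighbours: \<open>V'\<close> replaces \<open>V\<close>, and \<open>U'\<close> replaces \<open>U\<close>. Leading terms are
taken along \<open>U = 0\<close>, where the leading coefficients are series in \<open>X\<close>, the value of \<open>V\<close>. Both
\<open>(y\<^sub>1, y\<^sub>2)\<close> and \<open>(y\<^sub>2, y\<^sub>1)\<close> are instances, so one argument covers the two reflections.\<close>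

locale exchange_chart = leading_term ev t U
  for ev :: "rat poly poly \<Rightarrow> rat fls" and t and U :: ratfun2 +
  fixes V V' U' :: ratfun2 and b c :: nat
  assumes ev_nth_0: "fls_nth (ev N) 0 = coeff (coeff N 0) 0"
    and ev_nth_neg: "n < 0 \<Longrightarrow> fls_nth (ev N) n = 0"
    and lead_V: "lead V 0 fls_X"
    and exch_V: "V * V' = U ^ b + 1"
    and exch_U: "U * U' = V ^ c + 1"
    and b_pos: "0 < b" and c_pos: "0 < c"
begin

lemma V_nz: "V \<noteq> 0"
proof
  assume "V = 0"
  then have "lead V 0 0" using lead_0[of 0] by simp
  from lead_unique[OF lead_V this] show False by simp
qed

text \<open>On \<open>U = 0\<close> the relation \<open>V V' = U\<^sup>b + 1\<close> becomes \<open>V V' = 1\<close>. Hence exchanging \<open>V\<close> for \<open>V'\<close> acts on leading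
coefficients by \<open>X \<mapsto> 1 / X\<close>.\<close>

lemma lead_V': "lead V' 0 (fls_X powi - 1)"
proof -
  have "lead (U ^ b) 0 0"
    using lead_power[OF lead_U, of b] lead_below[of "U ^ b" "int b * 1" "1 ^ b" 0] b_pos by simp
  then have "lead (U ^ b + 1) 0 1" using lead_add[OF _ lead_1] by fastforce
  from lead_mult[OF this lead_inverse[OF lead_V]]
  have "lead ((U ^ b + 1) * inverse V) 0 (inverse fls_X)" by simp
  moreover have "(U ^ b + 1) * inverse V = V'" using V_nz by (simp add: exch_V[symmetric])
  ultimately show ?thesis by (metis power_int_minus power_int_1_right)
qed

lemma lead_U': "lead U' (- 1) (fls_X ^ c + 1)"
proof -
  have "lead (V ^ c + 1) 0 (fls_X ^ c + 1)"
    using lead_power[OF lead_V, of c] lead_add[OF _ lead_1] by fastforce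
  from lead_mult[OF this lead_inverse[OF lead_U]]
  have "lead ((V ^ c + 1) * inverse U) (- 1) (fls_X ^ c + 1)" by simp
  moreover have "(V ^ c + 1) * inverse U = U'" using U_nz by (simp add: exch_U[symmetric])
  ultimately show ?thesis by metis
qed

text \<open>The leading coefficient collects the monomials with the least exponent of \<open>U\<close>. The parameter
\<open>e\<close> is \<open>1\<close> for \<open>W = V\<close> and \<open>- 1\<close> for the exchanged variable; since the exponent \<open>k\<close> depends on \<open>f\<close>
alone, both substitutions into one \<open>f\<close> have the same order along \<open>U = 0\<close>.\<close>

lemma lead_laurent_UV:
  fixes e :: int
  assumes W: "lead W 0 (fls_X powi e)" and e: "e = 1 \<or> e = - 1" and "Poly_Mapping.keys f \<noteq> {}"
    and k: "k = Min (fst ` Poly_Mapping.keys f)"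
  obtains p where "lead (laurent_eval U W f) k p"
    "\<And>n. fls_nth p n = of_int (Poly_Mapping.lookup f (k, e * n))"
proof
  let ?K = "Poly_Mapping.keys f"
  let ?p = "\<lambda>s. of_int (Poly_Mapping.lookup f s) * (fls_X powi e) powi snd s :: rat fls"
  have t: "lead (of_int (Poly_Mapping.lookup f s) * (U powi fst s * W powi snd s)) (fst s) (?p s)" for s
    using lead_mult[OF lead_of_int lead_mult[OF lead_powi[OF lead_U, of "fst s"] lead_powi[OF W, of "snd s"]]]
    by (simp del: fls_X_power_int)
  have "lead (laurent_eval U W f) k (\<Sum>s\<in>{s\<in>?K. fst s = k}. ?p s)"
    unfolding laurent_eval_def case_prod_beta prod.collapse
    by (rule lead_sum[OF _ t]) (auto simp: k)
  then show "lead (laurent_eval U W f) k (\<Sum>s\<in>{s\<in>?K. fst s = k}. ?p s)" .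
  fix n
  have pw: "(fls_X powi e) powi j = (fls_X_intpow (e * j) :: rat fls)" for j
    by (simp only: power_int_mult fls_X_power_int[symmetric])
  have "fls_nth (\<Sum>s\<in>{s\<in>?K. fst s = k}. ?p s) n =
      (\<Sum>s\<in>{s\<in>?K. fst s = k}. if s = (k, e * n) then of_int (Poly_Mapping.lookup f s) else 0)"
    unfolding fls_nth_sum pw fls_nth_of_int_mult using e
    by (intro sum.cong) (auto simp: prod_eq_iff)
  also have "\<dots> = of_int (Poly_Mapping.lookup f (k, e * n))"
    by (auto simp: sum.delta in_keys_iff)
  finally show "fls_nth (\<Sum>s\<in>{s\<in>?K. fst s = k}. ?p s) n = \<dots>" .
qed

text \<open>In the cluster that contains \<open>U'\<close>, the order along \<open>U = 0\<close> is minus the largest exponent of \<open>U'\<close>, and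
every monomial attaining it contributes the same power of \<open>X\<^sup>c + 1\<close>. This is where divisibility of the
leading coefficient comes from.\<close>

lemma lead_laurent_VU':
  assumes "Poly_Mapping.keys h \<noteq> {}" and J: "J = Max (snd ` Poly_Mapping.keys h)"
  obtains H where "lead (laurent_eval V U' h) (- J) (H * (fls_X ^ c + 1) powi J)"
    "\<And>n. fls_nth H n = of_int (Poly_Mapping.lookup h (n, J))"
proof
  let ?K = "Poly_Mapping.keys h"
  let ?p = "\<lambda>s. of_int (Poly_Mapping.lookup h s) * (fls_X powi fst s * (fls_X ^ c + 1) powi snd s) :: rat fls"
  let ?H = "\<Sum>s\<in>{s\<in>?K. snd s = J}. of_int (Poly_Mapping.lookup h s) * fls_X powi fst s :: rat fls"
  have t: "lead (of_int (Poly_Mapping.lookup h s) * (V powi fst s * U' powi snd s)) (- snd s) (?p s)" for s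
    using lead_mult[OF lead_of_int lead_mult[OF lead_powi[OF lead_V, of "fst s"]
      lead_powi[OF lead_U' one_plus_X_power_nonzero[OF c_pos], of "snd s"]]]
    by (simp del: fls_X_power_int)
  have "lead (laurent_eval V U' h) (- J) (\<Sum>s\<in>{s\<in>?K. - snd s = - J}. ?p s)"
    unfolding laurent_eval_def case_prod_beta prod.collapse
    by (rule lead_sum[OF _ t]) (auto simp: J)
  also have "(\<Sum>s\<in>{s\<in>?K. - snd s = - J}. ?p s) = ?H * (fls_X ^ c + 1) powi J"
    unfolding sum_distrib_right by (intro sum.cong) (auto simp: mult_ac)
  finally show "lead (laurent_eval V U' h) (- J) (?H * (fls_X ^ c + 1) powi J)" .
  fix n
  have "fls_nth ?H n =
      (\<Sum>s\<in>{s\<in>?K. snd s = J}. if s = (n, J) then of_int (Poly_Mapping.lookup h s) else 0)"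
    unfolding fls_nth_sum fls_X_power_int fls_nth_of_int_mult
    by (intro sum.cong) (auto simp: algebra_simps prod_eq_iff)
  also have "\<dots> = of_int (Poly_Mapping.lookup h (n, J))"
    by (auto simp: sum.delta in_keys_iff)
  finally show "fls_nth ?H n = \<dots>" .
qed

lemma finite_support_lookup:
  fixes H :: "rat fls"
  assumes "\<And>n. fls_nth H n = of_int (Poly_Mapping.lookup f (\<phi> n))" "inj \<phi>"
  shows "finite {n. fls_nth H n \<noteq> 0}"
proof (rule finite_imageD)
  show "finite (\<phi> ` {n. fls_nth H n \<noteq> 0})"
    by (rule finite_subset[of _ "Poly_Mapping.keys f"]) (auto simp: assms(1) in_keys_iff)
  show "inj_on \<phi> {n. fls_nth H n \<noteq> 0}" using assms(2) by (rule inj_on_subset) simp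
qed

lemma laurent_eval_keys_empty: "Poly_Mapping.keys f = {} \<Longrightarrow> laurent_eval u v f = 0"
  by (simp add: laurent_eval_def)

text \<open>Here \<open>g\<close> is the map on denominator vectors induced by exchanging \<open>V\<close> for \<open>V'\<close>. The leading coefficient of
\<open>x \<beta>\<close> is a Laurent polynomial in \<open>X\<close> whose lowest exponent is \<open>- \<beta>\<^sub>2\<close>. The exchange inverts \<open>X\<close>, so the
highest exponent is the second component of \<open>g \<beta>\<close>, and the claim is that the width of the support is
exactly \<open>c max(\<beta>\<^sub>1, 0)\<close>. Divisibility by a power of \<open>X\<^sup>c + 1\<close> bounds the width from below. For the upper
bound a monomial in \<open>U, U', V, V'\<close>, whose leading coefficient is as narrow as possible, is expanded in the elements \<open>x \<gamma>\<close>. In the lowest-order part of that expansion the lowest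
exponents are pairwise distinct, and so are the highest ones because \<open>g\<close> is injective; all these
extreme coefficients are \<open>1\<close>. Hence nothing cancels at either end, and each term has to fit into the
narrow support.\<close>

lemma reflected_denominator_vector:
  fixes x :: "int \<times> int \<Rightarrow> ratfun2" and g :: "int \<times> int \<Rightarrow> int \<times> int"
  assumes den: "\<And>\<beta>. \<exists>N. coeff (coeff N 0) 0 = 1 \<and>
      x \<beta> = to_fract N / (U powi fst \<beta> * V powi snd \<beta>)"
    and exp: "\<And>\<beta>. \<exists>f. x \<beta> = laurent_eval U V f \<and> x (g \<beta>) = laurent_eval U V' f"
    and exp': "\<And>\<beta>. \<exists>h. x \<beta> = laurent_eval V U' h"
    and g: "inj g"
    and span: "\<And>a1 a2. \<exists>S n. finite S \<and> (\<forall>\<gamma>\<in>S. n \<gamma> \<noteq> 0) \<and>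
      U' ^ nat a1 * U ^ nat (- a1) * (V' ^ nat a2 * V ^ nat (- a2)) =
      (\<Sum>\<gamma>\<in>S. of_int (n \<gamma>) * x \<gamma>)"
  shows "g (a1, a2) = (a1, int c * max a1 0 - a2)"
proof -
  have "\<exists>p. lead (x \<beta>) (- fst \<beta>) p \<and> fls_nth p (- snd \<beta>) = 1 \<and>
      (\<forall>n < - snd \<beta>. fls_nth p n = 0)" for \<beta>
  proof -
    obtain N where N: "coeff (coeff N 0) 0 = 1" "x \<beta> = to_fract N / (U powi fst \<beta> * V powi snd \<beta>)"
      using den by blast
    have "x \<beta> = to_fract N * (U powi (- fst \<beta>) * V powi (- snd \<beta>))"
      by (simp add: N(2) power_int_minus field_simps)
    moreover have "lead (to_fract N * (U powi (- fst \<beta>) * V powi (- snd \<beta>))) (- fst \<beta>)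
        (ev N * fls_X_intpow (- snd \<beta>))"
      using lead_mult[OF lead_to_fract[of N] lead_mult[OF lead_powi[OF lead_U, of "- fst \<beta>"]
        lead_powi[OF lead_V, of "- snd \<beta>"]]] by simp
    moreover have "fls_nth (ev N * fls_X_intpow (- snd \<beta>)) n = fls_nth (ev N) (n + snd \<beta>)" for n
      by (simp only: fls_X_intpow_times_conv_shift) simp
    ultimately show ?thesis
      by (intro exI[of _ "ev N * fls_X_intpow (- snd \<beta>)"]) (simp add: ev_nth_0 ev_nth_neg N(1))
  qed
  then obtain p where p_lead: "\<And>\<beta>. lead (x \<beta>) (- fst \<beta>) (p \<beta>)"
    and p_low: "\<And>\<beta>. fls_nth (p \<beta>) (- snd \<beta>) = 1"
    and p_below: "\<And>\<beta> n. n < - snd \<beta> \<Longrightarrow> fls_nth (p \<beta>) n = 0" by metis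
  have p_nz: "p \<beta> \<noteq> 0" for \<beta> using p_low[of \<beta>] by auto
  have x_nz: "x \<beta> \<noteq> 0" for \<beta>
    using p_lead[of \<beta>] p_nz[of \<beta>] lead_0[of "- fst \<beta>"] lead_unique by metis
  have g_refl: "fst (g \<beta>) = fst \<beta> \<and> (\<forall>n. fls_nth (p (g \<beta>)) n = fls_nth (p \<beta>) (- n)) \<and>
      finite {n. fls_nth (p \<beta>) n \<noteq> 0}" for \<beta>
  proof -
    obtain f where f: "x \<beta> = laurent_eval U V f" "x (g \<beta>) = laurent_eval U V' f"
      using exp by blast
    have ne: "Poly_Mapping.keys f \<noteq> {}" using f(1) x_nz laurent_eval_keys_empty by metis
    define k where "k = Min (fst ` Poly_Mapping.keys f)"
    obtain q where q: "lead (x \<beta>) k q" "\<And>n. fls_nth q n = of_int (Poly_Mapping.lookup f (k, n))"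
      using lead_laurent_UV[of V 1 f k] lead_V ne f(1) by (auto simp: k_def)
    obtain q' where q': "lead (x (g \<beta>)) k q'"
      "\<And>n. fls_nth q' n = of_int (Poly_Mapping.lookup f (k, - n))"
      using lead_laurent_UV[OF lead_V' _ ne k_def] f(2) by auto
    have "k \<in> fst ` Poly_Mapping.keys f" unfolding k_def using ne by (intro Min_in) auto
    then obtain j where "(k, j) \<in> Poly_Mapping.keys f" by auto
    then have "fls_nth q j \<noteq> 0" "fls_nth q' (- j) \<noteq> 0" by (auto simp: q(2) q'(2) in_keys_iff)
    then have nz: "q \<noteq> 0" "q' \<noteq> 0" by auto
    have 1: "k = - fst \<beta>" "q = p \<beta>"
      using lead_order_unique[OF q(1) p_lead nz(1) p_nz] by auto
    have 2: "k = - fst (g \<beta>)" "q' = p (g \<beta>)"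
      using lead_order_unique[OF q'(1) p_lead nz(2) p_nz] by auto
    have "finite {n. fls_nth (p \<beta>) n \<noteq> 0}"
      using q(2) unfolding 1(2) by (rule finite_support_lookup) (auto simp: inj_def)
    then show ?thesis using 1 2 q(2) q'(2) by auto
  qed
  have p_high: "fls_nth (p \<beta>) (snd (g \<beta>)) = 1" for \<beta>
    using g_refl[of \<beta>] p_low[of "g \<beta>"] by auto
  have p_above: "fls_nth (p \<beta>) n = 0" if "n > snd (g \<beta>)" for \<beta> n
    using g_refl[of \<beta>] p_below[of "- n" "g \<beta>"] that by auto
  \<comment> \<open>The leading coefficient is divisible by the power of \<open>X\<^sup>c + 1\<close> with exponent \<open>max(\<beta>\<^sub>1, 0)\<close>.\<close>
  have lower: "int c * max (fst \<beta>) 0 - snd \<beta> \<le> snd (g \<beta>)" for \<beta>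
  proof -
    have "\<exists>H. p \<beta> = H * (fls_X ^ c + 1) ^ nat (fst \<beta>) \<and> finite {n. fls_nth H n \<noteq> 0}"
    proof (cases "fst \<beta> \<le> 0")
      case True
      then show ?thesis using g_refl[of \<beta>] by auto
    next
      case False
      obtain h where h: "x \<beta> = laurent_eval V U' h" using exp' by blast
      have ne: "Poly_Mapping.keys h \<noteq> {}" using h x_nz laurent_eval_keys_empty by metis
      define J where "J = Max (snd ` Poly_Mapping.keys h)"
      obtain H where H: "lead (x \<beta>) (- J) (H * (fls_X ^ c + 1) powi J)"
        "\<And>n. fls_nth H n = of_int (Poly_Mapping.lookup h (n, J))"
        using lead_laurent_VU'[OF ne J_def] unfolding h by blast
      have "J \<in> snd ` Poly_Mapping.keys h" unfolding J_def using ne by (intro Max_in) auto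
      then obtain j where "(j, J) \<in> Poly_Mapping.keys h" by auto
      then have "fls_nth H j \<noteq> 0" by (auto simp: H(2) in_keys_iff)
      then have "H * (fls_X ^ c + 1) powi J \<noteq> 0"
        using one_plus_X_power_nonzero[OF c_pos] by auto
      from lead_order_unique[OF H(1) p_lead this p_nz]
      have "J = fst \<beta>" "p \<beta> = H * (fls_X ^ c + 1) powi J" by auto
      moreover have "finite {n. fls_nth H n \<noteq> 0}"
        using H(2) by (rule finite_support_lookup) (auto simp: inj_def)
      ultimately show ?thesis using False by (auto simp: power_int_def)
    qed
    then obtain H where H: "p \<beta> = H * (fls_X ^ c + 1) ^ nat (fst \<beta>)"
      "finite {n. fls_nth H n \<noteq> 0}" by blast
    have "H \<noteq> 0" using H(1) p_nz[of \<beta>] by auto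
    from fls_one_plus_X_power_support[OF H(2) this c_pos, of "nat (fst \<beta>)"]
    obtain i j where ij: "fls_nth (p \<beta>) i \<noteq> 0" "fls_nth (p \<beta>) j \<noteq> 0"
      "i + int c * int (nat (fst \<beta>)) \<le> j" unfolding H(1) by blast
    have "- snd \<beta> \<le> i" "j \<le> snd (g \<beta>)"
      using ij(1,2) p_below[of i \<beta>] p_above[of \<beta> j] by force+
    moreover have "int (nat (fst \<beta>)) = max (fst \<beta>) 0" by auto
    with ij(3) have "i + int c * max (fst \<beta>) 0 \<le> j" by simp
    ultimately show ?thesis by linarith
  qed
  \<comment> \<open>Leading coefficient of the monomial with denominator vector \<open>(a\<^sub>1, a\<^sub>2)\<close> in \<open>U, U', V, V'\<close>.\<close>
  let ?m = "fls_X_intpow (- a2) * (fls_X ^ c + 1) ^ nat a1 :: rat fls"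
  have m_nz: "?m \<noteq> 0" using one_plus_X_power_nonzero[OF c_pos] by (simp add: fls_shift_eq0_iff)
  obtain S n where S: "finite S" "\<forall>\<gamma>\<in>S. n \<gamma> \<noteq> 0"
    and M: "U' ^ nat a1 * U ^ nat (- a1) * (V' ^ nat a2 * V ^ nat (- a2)) =
      (\<Sum>\<gamma>\<in>S. of_int (n \<gamma>) * x \<gamma>)"
    using span[of a1 a2] by (elim exE conjE) (rule that)
  have "lead (U' ^ nat a1 * U ^ nat (- a1) * (V' ^ nat a2 * V ^ nat (- a2)))
      (int (nat a1) * - 1 + int (nat (- a1)) * 1 + (int (nat a2) * 0 + int (nat (- a2)) * 0))
      ((fls_X ^ c + 1) ^ nat a1 * 1 ^ nat (- a1) * ((fls_X powi - 1) ^ nat a2 * fls_X ^ nat (- a2)))"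
    by (intro lead_mult lead_power lead_U lead_V lead_U' lead_V')
  moreover have "(fls_X powi - 1) ^ nat a2 * fls_X ^ nat (- a2) = (fls_X_intpow (- a2) :: rat fls)"
    by (simp only: fls_X_power_int fls_X_power_conv_shift_1 fls_X_intpow_power
      fls_X_intpow_times_fls_X_intpow) (cases "0 \<le> a2"; simp)
  moreover have "int (nat a1) * - 1 + int (nat (- a1)) * 1 +
      (int (nat a2) * 0 + int (nat (- a2)) * 0) = - a1" by auto
  ultimately have lead_M: "lead (\<Sum>\<gamma>\<in>S. of_int (n \<gamma>) * x \<gamma>) (- a1) ?m"
    by (simp only: M power_one mult_1_left mult_1_right mult.commute)
  have "S \<noteq> {}"
  proof
    assume "S = {}"
    then have "lead 0 (- a1) ?m" using lead_M by simp
    then show False using lead_0 lead_unique m_nz by blast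
  qed
  \<comment> \<open>The terms with the largest \<open>U\<close>-denominator carry the leading coefficient of the sum.\<close>
  define K where "K = Max (fst ` S)"
  have "K \<in> fst ` S" unfolding K_def using S(1) \<open>S \<noteq> {}\<close> by (intro Max_in) auto
  let ?T = "{\<gamma> \<in> S. - fst \<gamma> = - K}"
  let ?s = "\<Sum>\<gamma>\<in>?T. of_int (n \<gamma>) * p \<gamma>"
  have T: "finite ?T" "?T \<noteq> {}" using S(1) \<open>K \<in> fst ` S\<close> by auto
  have lead_s: "lead (\<Sum>\<gamma>\<in>S. of_int (n \<gamma>) * x \<gamma>) (- K) ?s"
  proof (rule lead_sum[OF S(1)])
    show "lead (of_int (n \<gamma>) * x \<gamma>) (- fst \<gamma>) (of_int (n \<gamma>) * p \<gamma>)" for \<gamma>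
      using lead_mult[OF lead_of_int p_lead] by simp
    show "- K \<le> - fst \<gamma>" if "\<gamma> \<in> S" for \<gamma> using that S(1) by (auto simp: K_def)
  qed
  have s_nth: "fls_nth ?s i = (\<Sum>\<gamma>\<in>?T. of_int (n \<gamma>) * fls_nth (p \<gamma>) i)" for i
    by (simp only: fls_nth_sum fls_nth_of_int_mult)
  have s_single: "fls_nth ?s i = of_int (n \<gamma>) * fls_nth (p \<gamma>) i"
    if "\<gamma> \<in> ?T" "\<And>\<delta>. \<delta> \<in> ?T \<Longrightarrow> \<delta> \<noteq> \<gamma> \<Longrightarrow> fls_nth (p \<delta>) i = 0" for \<gamma> i
    unfolding s_nth using that T(1) by (subst sum.remove[of _ \<gamma>]) (auto intro!: sum.neutral)
  \<comment> \<open>The lowest exponent in the sum comes from exactly one term, which therefore has denominator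
    vector \<open>(a\<^sub>1, a\<^sub>2)\<close>.\<close>
  define L where "L = Max (snd ` ?T)"
  have "L \<in> snd ` ?T" unfolding L_def using T by (intro Max_in) auto
  then obtain \<gamma> where \<gamma>: "\<gamma> \<in> ?T" "snd \<gamma> = L" by auto
  have L_ge: "snd \<delta> \<le> L" if "\<delta> \<in> ?T" for \<delta> unfolding L_def using that T by auto
  have "fls_nth ?s (- L) = of_int (n \<gamma>) * fls_nth (p \<gamma>) (- L)"
  proof (rule s_single[OF \<gamma>(1)])
    fix \<delta> assume "\<delta> \<in> ?T" "\<delta> \<noteq> \<gamma>"
    then have "snd \<delta> < L" using L_ge[of \<delta>] \<gamma> by (auto simp: prod_eq_iff)
    then show "fls_nth (p \<delta>) (- L) = 0" using p_below by simp
  qed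
  then have s_L: "fls_nth ?s (- L) \<noteq> 0" using \<gamma> S(2) p_low[of \<gamma>] by auto
  then have s_nz: "?s \<noteq> 0" by (metis fls_zero_nth)
  have Ka: "K = a1" and sm: "?s = ?m"
    using lead_order_unique[OF lead_s lead_M s_nz m_nz] by auto
  have "fls_subdegree ?m = - a2"
    using one_plus_X_power_nonzero[OF c_pos] fls_subdegree_one_plus_X_power[OF c_pos]
    by (subst fls_subdegree_mult) (auto simp: fls_shift_eq0_iff)
  moreover have "fls_subdegree ?s = - L"
  proof (rule fls_subdegree_eqI[OF s_L])
    fix i assume "i < - L"
    then have "fls_nth (p \<delta>) i = 0" if "\<delta> \<in> ?T" for \<delta>
      using p_below[of i \<delta>] L_ge[OF that] by linarith
    then show "fls_nth ?s i = 0" unfolding s_nth by (intro sum.neutral) simp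
  qed
  ultimately have "L = a2" using sm by simp
  then have \<gamma>_eq: "\<gamma> = (a1, a2)" using \<gamma> Ka by (auto simp: prod_eq_iff)
  \<comment> \<open>The highest exponent in the sum also comes from exactly one term, so it is visible in \<open>?m\<close>.\<close>
  define R where "R = Max ((\<lambda>\<delta>. snd (g \<delta>)) ` ?T)"
  have "R \<in> (\<lambda>\<delta>. snd (g \<delta>)) ` ?T" unfolding R_def using T by (intro Max_in) auto
  then obtain \<delta> where \<delta>: "\<delta> \<in> ?T" "snd (g \<delta>) = R" by auto
  have R_ge: "snd (g \<epsilon>) \<le> R" if "\<epsilon> \<in> ?T" for \<epsilon> unfolding R_def using that T by auto
  have "fls_nth ?s R = of_int (n \<delta>) * fls_nth (p \<delta>) R"
  proof (rule s_single[OF \<delta>(1)])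
    fix \<epsilon> assume \<epsilon>: "\<epsilon> \<in> ?T" "\<epsilon> \<noteq> \<delta>"
    then have "g \<epsilon> \<noteq> g \<delta>" using g by (auto dest: injD)
    moreover have "fst (g \<epsilon>) = fst (g \<delta>)" using g_refl \<epsilon>(1) \<delta>(1) by auto
    ultimately have "snd (g \<epsilon>) < R" using R_ge[OF \<epsilon>(1)] \<delta>(2) by (auto simp: prod_eq_iff)
    then show "fls_nth (p \<epsilon>) R = 0" by (rule p_above)
  qed
  then have "fls_nth ?m R \<noteq> 0" using \<delta> S(2) p_high[of \<delta>] sm by auto
  moreover have "fls_nth ?m i = 0" if "i > - a2 + int c * int (nat a1)" for i
    using fls_one_plus_X_power_top[OF c_pos, of "- a2" "fls_X_intpow (- a2)" "nat a1"] that
    by simp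
  ultimately have "R \<le> - a2 + int c * int (nat a1)" by (meson not_le)
  moreover have "int (nat a1) = max a1 0" by auto
  ultimately have "snd (g (a1, a2)) \<le> int c * max a1 0 - a2"
    using R_ge[OF \<gamma>(1)] \<gamma>_eq by simp
  then show ?thesis
    using lower[of "(a1, a2)"] g_refl[of "(a1, a2)"] by (simp add: prod_eq_iff)
qed

end

section \<open>The two coordinate axes\<close>

lemma map_poly_coeff_0_mult:
  fixes p q :: "'a::comm_semiring_1 poly poly"
  shows "map_poly (\<lambda>r. coeff r 0) (p * q) =
    map_poly (\<lambda>r. coeff r 0) p * map_poly (\<lambda>r. coeff r 0) q"
  by (intro poly_eqI) (simp add: coeff_map_poly coeff_mult coeff_mult_0 coeff_sum)

lemma map_poly_coeff_0_add:
  fixes p q :: "'a::comm_semiring_1 poly poly"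
  shows "map_poly (\<lambda>r. coeff r 0) (p + q) =
    map_poly (\<lambda>r. coeff r 0) p + map_poly (\<lambda>r. coeff r 0) q"
  by (intro poly_eqI) (simp add: coeff_map_poly)

text \<open>Polynomials in \<open>y\<^sub>2\<close> over \<open>\<rat>[y\<^sub>1]\<close> restricted to the axes \<open>y\<^sub>1 = 0\<close> and \<open>y\<^sub>2 = 0\<close>; the remaining
variable becomes \<open>X\<close>. Values are taken in Laurent series since these form a field in which
coefficients can be read off directly.\<close>

definition eval_Y1_0 :: "rat poly poly \<Rightarrow> rat fls" where
  "eval_Y1_0 N = fps_to_fls (fps_of_poly (map_poly (\<lambda>r. coeff r 0) N))"

definition eval_Y2_0 :: "rat poly poly \<Rightarrow> rat fls" where
  "eval_Y2_0 N = fps_to_fls (fps_of_poly (coeff N 0))"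

lemma leading_term_Y1: "leading_term eval_Y1_0 [:[:0, 1:]:] Y1"
proof
  show "eval_Y1_0 (p * q) = eval_Y1_0 p * eval_Y1_0 q" for p q
    by (simp add: eval_Y1_0_def map_poly_coeff_0_mult fps_of_poly_mult fls_times_fps_to_fls)
qed (simp_all add: eval_Y1_0_def map_poly_coeff_0_add fps_of_poly_add map_poly_1 map_poly_pCons Y1_def)

lemma leading_term_Y2: "leading_term eval_Y2_0 [:0, 1:] Y2"
proof
  show "eval_Y2_0 (p * q) = eval_Y2_0 p * eval_Y2_0 q" for p q
    by (simp add: eval_Y2_0_def coeff_mult_0 fps_of_poly_mult fls_times_fps_to_fls)
qed (simp_all add: eval_Y2_0_def fps_of_poly_add Y2_def)

lemma exchange_chart_Y1:
  assumes "0 < b" "0 < c"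
  shows "exchange_chart eval_Y1_0 [:[:0, 1:]:] Y1 Y2 (cluster_var b c 0) (cluster_var b c 3) b c"
proof -
  interpret leading_term eval_Y1_0 "[:[:0, 1:]:]" Y1 by (rule leading_term_Y1)
  show ?thesis
  proof
    show "fls_nth (eval_Y1_0 N) 0 = coeff (coeff N 0) 0" for N
      by (simp add: eval_Y1_0_def coeff_map_poly)
    show "fls_nth (eval_Y1_0 N) n = 0" if "n < 0" for N n
      using that by (simp add: eval_Y1_0_def)
    have "eval_Y1_0 [:0, 1:] = fls_X"
      by (simp add: eval_Y1_0_def map_poly_pCons fps_of_poly_pCons)
    then show "lead Y2 0 fls_X" using lead_to_fract[of "[:0, 1:]"] by (simp add: Y2_def)
    show "Y2 * cluster_var b c 0 = Y1 ^ b + 1"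
      using exchange_relation[of b c 1] by (simp add: cluster_var_1 cluster_var_2 mult.commute)
    show "Y1 * cluster_var b c 3 = Y2 ^ c + 1"
      using exchange_relation[of b c 2] by (simp add: cluster_var_1 cluster_var_2)
  qed (use assms in auto)
qed

lemma exchange_chart_Y2:
  assumes "0 < b" "0 < c"
  shows "exchange_chart eval_Y2_0 [:0, 1:] Y2 Y1 (cluster_var b c 3) (cluster_var b c 0) c b"
proof -
  interpret leading_term eval_Y2_0 "[:0, 1:]" Y2 by (rule leading_term_Y2)
  show ?thesis
  proof
    show "fls_nth (eval_Y2_0 N) 0 = coeff (coeff N 0) 0" for N
      by (simp add: eval_Y2_0_def)
    show "fls_nth (eval_Y2_0 N) n = 0" if "n < 0" for N n
      using that by (simp add: eval_Y2_0_def)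
    have "eval_Y2_0 [:[:0, 1:]:] = fls_X"
      by (simp add: eval_Y2_0_def fps_of_poly_pCons)
    then show "lead Y1 0 fls_X" using lead_to_fract[of "[:[:0, 1:]:]"] by (simp add: Y1_def)
    show "Y1 * cluster_var b c 3 = Y2 ^ c + 1"
      using exchange_relation[of b c 2] by (simp add: cluster_var_1 cluster_var_2)
    show "Y2 * cluster_var b c 0 = Y1 ^ b + 1"
      using exchange_relation[of b c 1] by (simp add: cluster_var_1 cluster_var_2 mult.commute)
  qed (use assms in auto)
qed

section \<open>Bases as sets of indecomposable positive elements\<close>

interpretation int_scale: module "int_scale :: int \<Rightarrow> 'a::ring_1 \<Rightarrow> 'a"
  by (rule module_int_scale)

lemma positive_combinations_iff:
  assumes "int_scale.independent B"
  shows "z \<in> positive_combinations B \<longleftrightarrow>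
    z \<in> int_scale.span B \<and> z \<noteq> 0 \<and> (\<forall>w. 0 \<le> int_scale.representation B z w)"
proof
  assume "z \<in> positive_combinations B"
  then obtain S n where S: "z = (\<Sum>w\<in>S. of_int (n w) * w)" "finite S" "S \<noteq> {}" "S \<subseteq> B"
    "\<forall>w\<in>S. n w > 0" by (auto simp: positive_combinations_def)
  have span: "z \<in> int_scale.span B"
    unfolding int_scale.span_explicit using S(1,2,4) by (auto simp: int_scale_def)
  have "int_scale.representation B z = (\<lambda>w. if w \<in> S then n w else 0)"
  proof (rule int_scale.representation_eqI[OF assms span])
    have eq: "{w. (if w \<in> S then n w else 0) \<noteq> 0} = S" using S(5) by auto
    show "(\<Sum>w | (if w \<in> S then n w else 0) \<noteq> 0. int_scale (if w \<in> S then n w else 0) w) = z"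
      unfolding eq S(1) by (simp add: int_scale_def)
    show "finite {w. (if w \<in> S then n w else 0) \<noteq> 0}" unfolding eq by (rule S(2))
  qed (use S(4) in \<open>auto split: if_splits\<close>)
  moreover have "z \<noteq> 0"
  proof
    assume "z = 0"
    obtain w where "w \<in> S" using S(3) by auto
    then have "int_scale.representation B z w > 0" using S(5) calculation by auto
    then show False using \<open>z = 0\<close> by (simp add: int_scale.representation_zero)
  qed
  ultimately show "z \<in> int_scale.span B \<and> z \<noteq> 0 \<and> (\<forall>w. 0 \<le> int_scale.representation B z w)"
    using span S(5) by (auto simp: less_imp_le)
next
  assume *: "z \<in> int_scale.span B \<and> z \<noteq> 0 \<and> (\<forall>w. 0 \<le> int_scale.representation B z w)"
  let ?n = "int_scale.representation B z"
  have z: "z = (\<Sum>w | ?n w \<noteq> 0. of_int (?n w) * w)"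
    using int_scale.sum_nonzero_representation_eq[OF assms, of z] * by (simp add: int_scale_def)
  have "{w. ?n w \<noteq> 0} \<noteq> {}"
  proof
    assume "{w. ?n w \<noteq> 0} = {}"
    then have "(\<Sum>w | ?n w \<noteq> 0. of_int (?n w) * w) = 0" by (simp only: sum.empty)
    with z * show False by simp
  qed
  then show "z \<in> positive_combinations B"
    unfolding positive_combinations_def using z * int_scale.finite_representation[of B z]
      int_scale.representation_ne_zero[of B z]
    by (intro CollectI exI[of _ "{w. ?n w \<noteq> 0}"] exI[of _ ?n]) (auto simp: order_less_le)
qed

text \<open>A basis is determined by the cone that it spans: its elements are the positive elements that are not sums
of two positive elements. Therefore any additive bijection that preserves positivity permutes
the basis.\<close>

lemma basis_eq_indecomposable_positive:
  assumes indep: "int_scale.independent B"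
  shows "B = {z \<in> positive_combinations B.
    \<not> (\<exists>u\<in>positive_combinations B. \<exists>v\<in>positive_combinations B. z = u + v)}"
    (is "B = ?R")
proof (intro set_eqI iffI)
  let ?rep = "int_scale.representation B"
  note pos = positive_combinations_iff[OF indep]
  have rep_nonzero: "\<exists>w. ?rep u w > 0" if "u \<in> positive_combinations B" for u
  proof (rule ccontr)
    assume "\<not> ?thesis"
    then have "?rep u w = 0" for w using that by (simp add: pos not_less order_antisym)
    then show False
      using int_scale.sum_nonzero_representation_eq[OF indep, of u] that by (simp add: pos)
  qed
  fix z
  { assume z: "z \<in> B"
    note rep_z = int_scale.representation_basis[OF indep z]
    have span: "z \<in> int_scale.span B" using z by (rule int_scale.span_base)
    have "z \<noteq> 0" using rep_z int_scale.representation_zero[of B] by (metis zero_neq_one)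
    then have "z \<in> positive_combinations B" using span by (simp add: pos rep_z)
    moreover have "z \<noteq> u + v"
      if u: "u \<in> positive_combinations B" and v: "v \<in> positive_combinations B" for u v
    proof
      assume "z = u + v"
      then have eq: "?rep z w = ?rep u w + ?rep v w" for w
        using int_scale.representation_add[OF indep, of u v] u v by (simp add: pos add.commute)
      obtain w w' where w: "?rep u w > 0" "?rep v w' > 0" using rep_nonzero u v by blast
      have nonneg: "?rep u i \<ge> 0" "?rep v i \<ge> 0" for i using u v by (auto simp: pos)
      have "w = z" using eq[of w] w(1) nonneg(2)[of w] unfolding rep_z by (auto split: if_splits)
      moreover have "w' = z" using eq[of w'] w(2) nonneg(1)[of w'] unfolding rep_z by (auto split: if_splits)
      ultimately show False using eq[of z] w unfolding rep_z by simp
    qed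
    ultimately show "z \<in> ?R" by blast }
  assume z: "z \<in> ?R"
  then obtain w where w: "?rep z w > 0" using rep_nonzero by blast
  then have wB: "w \<in> B" using int_scale.representation_ne_zero[of B z w] by simp
  note rep_w = int_scale.representation_basis[OF indep wB]
  have span: "z \<in> int_scale.span B" "w \<in> int_scale.span B"
    using z wB int_scale.span_base by (auto simp: pos)
  have "w \<noteq> 0" using rep_w int_scale.representation_zero[of B] by (metis zero_neq_one)
  then have wpos: "w \<in> positive_combinations B" using span by (simp add: pos rep_w)
  show "z \<in> B"
  proof (rule ccontr)
    assume "z \<notin> B"
    then have "z - w \<noteq> 0" using wB by auto
    moreover have "0 \<le> ?rep (z - w) i" for i
      using int_scale.representation_diff[OF indep span(2,1)] z w by (auto simp: pos rep_w)
    ultimately have "z - w \<in> positive_combinations B"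
      using span int_scale.span_diff by (simp add: pos)
    moreover have "z = (z - w) + w" by simp
    ultimately show False using z wpos by blast
  qed
qed

section \<open>Piecewise linear maps\<close>

lemma rational_cone_iff: "a \<in> rational_cone H \<longleftrightarrow> (\<forall>h\<in>H. 0 \<le> fst h * fst a + snd h * snd a)"
  by (auto simp: rational_cone_def case_prod_beta)

text \<open>On a cone of linearity \<open>H\<close> of \<open>g\<close>, each inequality defining a cone of linearity of \<open>f\<close> pulls back to another
homogeneous linear inequality; \<open>pull\<close> adjoins these to \<open>H\<close>.\<close>

lemma piecewise_linear_compose:
  assumes "piecewise_linear f" "piecewise_linear g"
  shows "piecewise_linear (f \<circ> g)"
proof -
  obtain F where F: "finite F" "\<forall>H\<in>F. finite H" "(\<Union>H\<in>F. rational_cone H) = UNIV"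
    "\<forall>H\<in>F. \<exists>p q r s. \<forall>(a1, a2)\<in>rational_cone H. f (a1, a2) = (p * a1 + q * a2, r * a1 + s * a2)"
    using assms(1) unfolding piecewise_linear_def by blast
  obtain G where G: "finite G" "\<forall>H\<in>G. finite H" "(\<Union>H\<in>G. rational_cone H) = UNIV"
    "\<forall>H\<in>G. \<exists>p q r s. \<forall>(a1, a2)\<in>rational_cone H. g (a1, a2) = (p * a1 + q * a2, r * a1 + s * a2)"
    using assms(2) unfolding piecewise_linear_def by blast
  from G(4) obtain p q r s where lin: "\<And>H a. H \<in> G \<Longrightarrow> a \<in> rational_cone H \<Longrightarrow>
      g a = (p H * fst a + q H * snd a, r H * fst a + s H * snd a)"
    unfolding case_prod_unfold prod.collapse by metis
  define pull where "pull H K =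
    H \<union> (\<lambda>h. (fst h * p H + snd h * r H, fst h * q H + snd h * s H)) ` K" for H K
  have pull_iff: "a \<in> rational_cone (pull H K) \<longleftrightarrow> a \<in> rational_cone H \<and> g a \<in> rational_cone K"
    if "H \<in> G" for a H K
    using lin[OF that, of a] unfolding pull_def rational_cone_iff
    by (auto simp: ball_Un algebra_simps)
  let ?S = "(\<lambda>(H, K). pull H K) ` (G \<times> F)"
  have fin: "finite ?S" using F(1) G(1) by simp
  have fin': "\<forall>H\<in>?S. finite H" using F(2) G(2) by (auto simp: pull_def)
  have cover: "(\<Union>H\<in>?S. rational_cone H) = UNIV"
  proof (intro UNIV_eq_I[symmetric] UNIV_I)
    fix a
    obtain H where "H \<in> G" "a \<in> rational_cone H" using G(3) by blast
    moreover obtain K where "K \<in> F" "g a \<in> rational_cone K" using F(3) by blast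
    ultimately have "pull H K \<in> ?S" "a \<in> rational_cone (pull H K)" using pull_iff by auto
    then show "a \<in> (\<Union>H\<in>?S. rational_cone H)" by (rule UN_I)
  qed
  have pull_lin: "\<exists>p' q' r' s'. \<forall>(a1, a2)\<in>rational_cone (pull H K).
      (f \<circ> g) (a1, a2) = (p' * a1 + q' * a2, r' * a1 + s' * a2)" if "H \<in> G" "K \<in> F" for H K
  proof -
    obtain p1 q1 r1 s1 where f: "\<And>a. a \<in> rational_cone K \<Longrightarrow>
        f a = (p1 * fst a + q1 * snd a, r1 * fst a + s1 * snd a)"
      using F(4) \<open>K \<in> F\<close> unfolding case_prod_unfold prod.collapse by metis
    show ?thesis
      by (rule exI[of _ "p1 * p H + q1 * r H"], rule exI[of _ "p1 * q H + q1 * s H"],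
          rule exI[of _ "r1 * p H + s1 * r H"], rule exI[of _ "r1 * q H + s1 * s H"])
        (auto simp: pull_iff[OF \<open>H \<in> G\<close>] f lin[OF \<open>H \<in> G\<close>] algebra_simps)
  qed
  have "\<forall>L\<in>?S. \<exists>p' q' r' s'. \<forall>(a1, a2)\<in>rational_cone L.
      (f \<circ> g) (a1, a2) = (p' * a1 + q' * a2, r' * a1 + s' * a2)"
  proof
    fix L assume "L \<in> ?S"
    then obtain H K where L: "L = pull H K" "H \<in> G" "K \<in> F" by auto
    show "\<exists>p' q' r' s'. \<forall>(a1, a2)\<in>rational_cone L.
        (f \<circ> g) (a1, a2) = (p' * a1 + q' * a2, r' * a1 + s' * a2)"
      unfolding L(1) using L(2,3) by (rule pull_lin)
  qed
  with fin fin' cover show ?thesis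
    unfolding piecewise_linear_def by (intro exI[of _ ?S] conjI)
qed

lemma piecewise_linear_reflections:
  "piecewise_linear (\<lambda>(a1, a2). (a1, k * max a1 0 - a2))"
  "piecewise_linear (\<lambda>(a1, a2). (k * max a2 0 - a1, a2))"
proof -
  show "piecewise_linear (\<lambda>(a1, a2). (a1, k * max a1 0 - a2))"
    unfolding piecewise_linear_def
  proof (intro exI[of _ "{{(1, 0)}, {(- 1, 0)}}"] conjI ballI)
    fix H :: "(int \<times> int) set" assume H: "H \<in> {{(1, 0)}, {(- 1, 0)}}"
    show "\<exists>p q r s. \<forall>(a1, a2)\<in>rational_cone H.
        (case (a1, a2) of (a1, a2) \<Rightarrow> (a1, k * max a1 0 - a2)) = (p * a1 + q * a2, r * a1 + s * a2)"
      by (rule exI[of _ 1], rule exI[of _ 0],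
          rule exI[of _ "if H = {(1, 0)} then k else 0"], rule exI[of _ "- 1"])
        (use H in \<open>auto simp: rational_cone_iff max_def\<close>)
  qed (auto simp: rational_cone_iff)
  show "piecewise_linear (\<lambda>(a1, a2). (k * max a2 0 - a1, a2))"
    unfolding piecewise_linear_def
  proof (intro exI[of _ "{{(0, 1)}, {(0, - 1)}}"] conjI ballI)
    fix H :: "(int \<times> int) set" assume H: "H \<in> {{(0, 1)}, {(0, - 1)}}"
    show "\<exists>p q r s. \<forall>(a1, a2)\<in>rational_cone H.
        (case (a1, a2) of (a1, a2) \<Rightarrow> (k * max a2 0 - a1, a2)) = (p * a1 + q * a2, r * a1 + s * a2)"
      by (rule exI[of _ "- 1"], rule exI[of _ "if H = {(0, 1)} then k else 0"],
          rule exI[of _ 0], rule exI[of _ 1])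
        (use H in \<open>auto simp: rational_cone_iff max_def\<close>)
  qed (auto simp: rational_cone_iff)
qed

section \<open>Reflections of the cluster algebra\<close>

lemma cluster_var_nonzero: "cluster_var b c m \<noteq> 0"
proof -
  have "cluster_var b c m > 0"
    by (simp add: cluster_var_def cluster_up_pos cluster_down_pos)
  then show ?thesis by simp
qed

lemma laurent_eval_swap:
  "laurent_eval v u (Poly_Mapping.map_key prod.swap f) = laurent_eval u v f"
  unfolding laurent_eval_def
  by (rule sum.reindex_bij_witness[of _ prod.swap prod.swap])
    (auto simp: keys_map_key map_key.rep_eq mult_ac)

text \<open>An automorphism of the cluster algebra says nothing about inverses of cluster variables, so Laurent
expansions are transported after multiplication by a monomial that makes all exponents nonnegative.\<close>

lemma laurent_eval_clear_denominators:
  fixes u v :: "'a::field"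
  assumes "u \<noteq> 0" "v \<noteq> 0" "\<And>k. k \<in> Poly_Mapping.keys f \<Longrightarrow> 0 \<le> fst k + int K \<and> 0 \<le> snd k + int K"
  shows "laurent_eval u v f * (u ^ K * v ^ K) = (\<Sum>k\<in>Poly_Mapping.keys f.
    of_int (Poly_Mapping.lookup f k) * (u ^ nat (fst k + int K) * v ^ nat (snd k + int K)))"
proof -
  have pw: "w ^ nat (i + int K) = w powi i * w ^ K" if "w \<noteq> 0" "0 \<le> i + int K" for w :: 'a and i
  proof -
    have "w ^ nat (i + int K) = w powi (i + int K)" using that(2) by (simp add: power_int_def)
    also have "\<dots> = w powi i * w powi int K" using that(1) by (simp add: power_int_add)
    finally show ?thesis by simp
  qed
  show ?thesis
    unfolding laurent_eval_def sum_distrib_right case_prod_beta prod.collapse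
    by (intro sum.cong) (use assms in \<open>auto simp: pw mult_ac\<close>)
qed

lemma laurent_exponent_bound:
  "\<exists>K. \<forall>k\<in>Poly_Mapping.keys f. 0 \<le> fst k + int K \<and> 0 \<le> snd k + int K"
proof -
  define K where "K = (\<Sum>k\<in>Poly_Mapping.keys f. nat \<bar>fst k\<bar> + nat \<bar>snd k\<bar>)"
  have "nat \<bar>fst k\<bar> + nat \<bar>snd k\<bar> \<le> K" if "k \<in> Poly_Mapping.keys f" for k
    unfolding K_def by (rule member_le_sum[OF that]) auto
  then show ?thesis by (intro exI[of _ K]) fastforce
qed

lemma cluster_algebra_closed:
  shows cluster_algebra_var: "cluster_var b c m \<in> cluster_algebra b c"
    and cluster_algebra_1: "1 \<in> cluster_algebra b c"
    and cluster_algebra_0: "0 \<in> cluster_algebra b c"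
    and cluster_algebra_diff: "u \<in> cluster_algebra b c \<Longrightarrow> v \<in> cluster_algebra b c \<Longrightarrow> u - v \<in> cluster_algebra b c"
    and cluster_algebra_add: "u \<in> cluster_algebra b c \<Longrightarrow> v \<in> cluster_algebra b c \<Longrightarrow> u + v \<in> cluster_algebra b c"
    and cluster_algebra_mult: "u \<in> cluster_algebra b c \<Longrightarrow> v \<in> cluster_algebra b c \<Longrightarrow> u * v \<in> cluster_algebra b c"
proof -
  show "cluster_var b c m \<in> cluster_algebra b c" "1 \<in> cluster_algebra b c"
    by (auto simp: cluster_algebra_def intro: subring_generated.intros)
  show diff: "u - v \<in> cluster_algebra b c" if "u \<in> cluster_algebra b c" "v \<in> cluster_algebra b c" for u v
    using that by (auto simp: cluster_algebra_def intro: subring_generated.intros)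
  show zero: "0 \<in> cluster_algebra b c"
    using diff[of 1 1] by (simp add: cluster_algebra_def subring_generated.one)
  show "u + v \<in> cluster_algebra b c" if "u \<in> cluster_algebra b c" "v \<in> cluster_algebra b c"
    using diff[OF that(1) diff[OF zero that(2)]] by simp
  show "u * v \<in> cluster_algebra b c" if "u \<in> cluster_algebra b c" "v \<in> cluster_algebra b c"
    using that by (auto simp: cluster_algebra_def intro: subring_generated.intros)
qed

lemma cluster_algebra_power: "u \<in> cluster_algebra b c \<Longrightarrow> u ^ n \<in> cluster_algebra b c"
  by (induction n) (auto intro: cluster_algebra_1 cluster_algebra_mult)

lemma cluster_algebra_of_int: "of_int n \<in> cluster_algebra b c"
proof -
  have nat: "of_nat m \<in> cluster_algebra b c" for m
    by (induction m) (auto intro: cluster_algebra_0 cluster_algebra_1 cluster_algebra_add)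
  have "of_int n = of_nat (nat n) - (of_nat (nat (- n)) :: ratfun2)" by (cases "n \<ge> 0") auto
  then show ?thesis using cluster_algebra_diff[OF nat nat] by simp
qed

lemma cluster_algebra_sum: "(\<And>i. i \<in> S \<Longrightarrow> h i \<in> cluster_algebra b c) \<Longrightarrow> sum h S \<in> cluster_algebra b c"
  by (induction S rule: infinite_finite_induct) (auto intro: cluster_algebra_0 cluster_algebra_add)

lemma ring_automorphism_on_diff:
  assumes "ring_automorphism_on (cluster_algebra b c) f" "u \<in> cluster_algebra b c" "v \<in> cluster_algebra b c"
  shows "f (u - v) = f u - f v"
proof -
  have "f ((u - v) + v) = f (u - v) + f v"
    using assms cluster_algebra_diff[OF assms(2,3)]
    by (simp only: ring_automorphism_on_def)
  then show ?thesis by simp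
qed

lemma ring_automorphism_on_compose:
  "ring_automorphism_on A f \<Longrightarrow> ring_automorphism_on A h \<Longrightarrow> ring_automorphism_on A (f \<circ> h)"
proof -
  assume f: "ring_automorphism_on A f" and h: "ring_automorphism_on A h"
  have "h u \<in> A" if "u \<in> A" for u
    using h that bij_betwE[of h A A] by (simp add: ring_automorphism_on_def)
  moreover have "bij_betw (f \<circ> h) A A"
    using f h bij_betw_trans[of h A A f A] by (simp add: ring_automorphism_on_def)
  ultimately show ?thesis using f h by (simp add: ring_automorphism_on_def)
qed

lemma ring_automorphism_on_id: "ring_automorphism_on A id"
  by (simp add: ring_automorphism_on_def)

text \<open>Every identity between composites of the reflections is verified on cluster variables only.\<close>

lemma ring_automorphism_on_eqI:
  assumes f: "ring_automorphism_on (cluster_algebra b c) f"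
    and h: "ring_automorphism_on (cluster_algebra b c) h"
    and gen: "\<And>m. f (cluster_var b c m) = h (cluster_var b c m)"
    and "z \<in> cluster_algebra b c"
  shows "f z = h z"
  using assms(4) unfolding cluster_algebra_def
proof (induction rule: subring_generated.induct)
  case one
  then show ?case using f h by (simp add: ring_automorphism_on_def)
next
  case (diff u v)
  then show ?case using ring_automorphism_on_diff[OF f, of u v] ring_automorphism_on_diff[OF h, of u v]
    by (simp add: cluster_algebra_def)
next
  case (mult u v)
  then show ?case using f h by (simp add: ring_automorphism_on_def cluster_algebra_def)
qed (use gen in auto)

locale cluster_reflection =
  fixes b c :: nat and s :: "ratfun2 \<Rightarrow> ratfun2" and p :: int
  assumes automorphism: "ring_automorphism_on (cluster_algebra b c) s"
    and reflects: "s (cluster_var b c m) = cluster_var b c (2 * p - m)"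
begin

lemma closed: "z \<in> cluster_algebra b c \<Longrightarrow> s z \<in> cluster_algebra b c"
  using automorphism bij_betwE[of s "cluster_algebra b c" "cluster_algebra b c"]
  by (simp add: ring_automorphism_on_def)

lemma hom:
  shows hom_1: "s 1 = 1"
    and hom_add: "u \<in> cluster_algebra b c \<Longrightarrow> v \<in> cluster_algebra b c \<Longrightarrow> s (u + v) = s u + s v"
    and hom_mult: "u \<in> cluster_algebra b c \<Longrightarrow> v \<in> cluster_algebra b c \<Longrightarrow> s (u * v) = s u * s v"
    and hom_diff: "u \<in> cluster_algebra b c \<Longrightarrow> v \<in> cluster_algebra b c \<Longrightarrow> s (u - v) = s u - s v"
  using automorphism ring_automorphism_on_diff[OF automorphism, of u v]
  by (simp_all add: ring_automorphism_on_def)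

lemma hom_0: "s 0 = 0"
  using hom_diff[OF cluster_algebra_1 cluster_algebra_1] by simp

lemma hom_power: "u \<in> cluster_algebra b c \<Longrightarrow> s (u ^ n) = s u ^ n"
  by (induction n) (auto simp: hom_1 hom_mult cluster_algebra_power)

lemma hom_of_int: "s (of_int n) = of_int n"
proof -
  have nat: "s (of_nat m) = of_nat m" for m
    using cluster_algebra_of_int[of "int _"]
    by (induction m) (auto simp: hom_0 hom_1 hom_add cluster_algebra_1)
  have "of_int n = of_nat (nat n) - (of_nat (nat (- n)) :: ratfun2)" by (cases "n \<ge> 0") auto
  then show ?thesis
    using hom_diff[of "of_nat (nat n)" "of_nat (nat (- n))"] nat
      cluster_algebra_of_int[of "int _"] by simp
qed

lemma hom_sum: "(\<And>i. i \<in> S \<Longrightarrow> h i \<in> cluster_algebra b c) \<Longrightarrow> s (sum h S) = (\<Sum>i\<in>S. s (h i))"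
  by (induction S rule: infinite_finite_induct) (auto simp: hom_0 hom_add cluster_algebra_sum)

lemma involution: "z \<in> cluster_algebra b c \<Longrightarrow> s (s z) = z"
  using ring_automorphism_on_eqI[OF ring_automorphism_on_compose[OF automorphism automorphism]
    ring_automorphism_on_id, of z] by (simp add: reflects)

lemma reflect_laurent_expansion:
  assumes z: "z \<in> cluster_algebra b c" "z = laurent_eval (cluster_var b c m) (cluster_var b c k) f"
  shows "s z = laurent_eval (cluster_var b c (2 * p - m)) (cluster_var b c (2 * p - k)) f"
proof -
  let ?u = "cluster_var b c m" and ?v = "cluster_var b c k"
  let ?u' = "cluster_var b c (2 * p - m)" and ?v' = "cluster_var b c (2 * p - k)"
  obtain K where K: "\<And>k. k \<in> Poly_Mapping.keys f \<Longrightarrow> 0 \<le> fst k + int K \<and> 0 \<le> snd k + int K"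
    using laurent_exponent_bound[of f] by blast
  note clear = laurent_eval_clear_denominators[OF cluster_var_nonzero cluster_var_nonzero K]
  note mem = cluster_algebra_var cluster_algebra_power cluster_algebra_mult cluster_algebra_of_int
  have "s z * (?u' ^ K * ?v' ^ K) = s (z * (?u ^ K * ?v ^ K))"
    using z(1) by (simp add: hom_mult hom_power reflects mem)
  also have "z * (?u ^ K * ?v ^ K) = (\<Sum>i\<in>Poly_Mapping.keys f.
    of_int (Poly_Mapping.lookup f i) * (?u ^ nat (fst i + int K) * ?v ^ nat (snd i + int K)))"
    unfolding z(2) by (rule clear)
  also have "s \<dots> = (\<Sum>i\<in>Poly_Mapping.keys f.
    of_int (Poly_Mapping.lookup f i) * (?u' ^ nat (fst i + int K) * ?v' ^ nat (snd i + int K)))"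
    by (subst hom_sum) (simp_all add: hom_mult hom_power hom_of_int reflects mem)
  also have "\<dots> = laurent_eval ?u' ?v' f * (?u' ^ K * ?v' ^ K)"
    by (rule clear[symmetric])
  finally show ?thesis by (simp add: cluster_var_nonzero)
qed

text \<open>A reflection sends the cluster \<open>(y\<^sub>m, y\<^sub>m\<^sub>+\<^sub>1)\<close> to another cluster in reversed order and keeps all
coefficients.\<close>

lemma positive_reflect:
  assumes "positive_element b c z" shows "positive_element b c (s z)"
  unfolding positive_element_def
proof (intro conjI allI)
  have z: "z \<in> cluster_algebra b c" "z \<noteq> 0" using assms by (auto simp: positive_element_def)
  show "s z \<in> cluster_algebra b c" using z(1) by (rule closed)
  show "s z \<noteq> 0" using z involution[OF z(1)] hom_0 by metis
  fix m
  obtain f where f: "z = laurent_eval (cluster_var b c (2 * p - m - 1))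
      (cluster_var b c (2 * p - m - 1 + 1)) f" "\<forall>k\<in>Poly_Mapping.keys f. Poly_Mapping.lookup f k > 0"
    using assms unfolding positive_element_def by blast
  have "s z = laurent_eval (cluster_var b c (m + 1)) (cluster_var b c m) f"
    using reflect_laurent_expansion[OF z(1) f(1)] by (simp add: algebra_simps)
  then have "s z = laurent_eval (cluster_var b c m) (cluster_var b c (m + 1))
      (Poly_Mapping.map_key prod.swap f)" by (simp only: laurent_eval_swap)
  moreover have "\<forall>k\<in>Poly_Mapping.keys (Poly_Mapping.map_key prod.swap f).
      Poly_Mapping.lookup (Poly_Mapping.map_key prod.swap f) k > 0"
    using f(2) by (auto simp: keys_map_key map_key.rep_eq)
  ultimately show "\<exists>f. s z = laurent_eval (cluster_var b c m) (cluster_var b c (m + 1)) f \<and>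
      (\<forall>k\<in>Poly_Mapping.keys f. Poly_Mapping.lookup f k > 0)" by blast
qed

end

section \<open>The action on denominator vectors\<close>

theorem theorem2p5:
  fixes b c :: nat
    and B :: "ratfun2 set"
    and x :: "int \<times> int \<Rightarrow> ratfun2"
    and \<sigma> :: "int \<Rightarrow> ratfun2 \<Rightarrow> ratfun2"
  assumes "0 < b" and "0 < c" and "b * c \<le> 4"
    and "is_canonical_basis b c B"
    and "is_denominator_parametrization B x"
    and "\<And>p. ring_automorphism_on (cluster_algebra b c) (\<sigma> p)"
    and "\<And>p m. \<sigma> p (cluster_var b c m) = cluster_var b c (2 * p - m)"
  shows "\<exists>g :: int \<Rightarrow> int \<times> int \<Rightarrow> int \<times> int.
    (\<forall>p \<alpha>. x (g p \<alpha>) = \<sigma> p (x \<alpha>)) \<and>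
    (\<forall>p. bij (g p) \<and> piecewise_linear (g p)) \<and>
    (\<forall>a1 a2. g 1 (a1, a2) = (a1, int c * max a1 0 - a2)) \<and>
    (\<forall>a1 a2. g 2 (a1, a2) = (int b * max a2 0 - a1, a2))"
proof -
  let ?A = "cluster_algebra b c" and ?y = "cluster_var b c"
  have reflection: "cluster_reflection b c (\<sigma> p) p" for p
    by standard (use assms(6,7) in auto)
  have indep: "int_scale.independent B" and span_B: "int_scale.span B = ?A"
    and pos_B: "positive_combinations B = {z. positive_element b c z}"
    using assms(4) by (auto simp: is_canonical_basis_def Z_basis_def)
  have x_iff: "z \<in> B \<and> has_denominator_vector z \<alpha> \<longleftrightarrow> z = x \<alpha>" for z \<alpha>
    using assms(5) by (simp only: is_denominator_parametrization_def)
  have x_bij: "bij_betw x UNIV B"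
    using assms(5) by (simp add: is_denominator_parametrization_def)
  have x_B: "x \<alpha> \<in> B" for \<alpha> using x_iff by blast
  have x_inj: "x \<alpha> = x \<beta> \<longleftrightarrow> \<alpha> = \<beta>" for \<alpha> \<beta>
    using x_bij by (auto simp: bij_betw_def inj_eq)
  note indecomposable = basis_eq_indecomposable_positive[OF indep, unfolded pos_B]
  have x_pos: "positive_element b c (x \<alpha>)" for \<alpha> using indecomposable x_B by blast
  have x_A: "x \<alpha> \<in> ?A" for \<alpha> using x_pos by (simp add: positive_element_def)
  \<comment> \<open>Indecomposability is invariant because the reflection is an additive involution on positive elements.\<close>
  have \<sigma>_B: "\<sigma> p z \<in> B" if "z \<in> B" for p z
  proof -
    interpret cluster_reflection b c "\<sigma> p" p by (rule reflection)
    have z: "positive_element b c z" "\<And>u v. positive_element b c u \<Longrightarrow> positive_element b c v \<Longrightarrow> z \<noteq> u + v"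
      using that indecomposable by blast+
    have "\<sigma> p z \<noteq> u + v" if "positive_element b c u" "positive_element b c v" for u v
    proof
      assume eq: "\<sigma> p z = u + v"
      have "z = \<sigma> p (\<sigma> p z)" using involution z(1) by (simp add: positive_element_def)
      also have "\<dots> = \<sigma> p u + \<sigma> p v"
        unfolding eq using that by (simp add: positive_element_def hom_add)
      finally show False using z(2) positive_reflect that by blast
    qed
    then show ?thesis using positive_reflect[OF z(1)] indecomposable by blast
  qed
  define g where "g p \<alpha> = (THE \<beta>. x \<beta> = \<sigma> p (x \<alpha>))" for p \<alpha>
  have g: "x (g p \<alpha>) = \<sigma> p (x \<alpha>)" for p \<alpha>
  proof -
    obtain \<beta> where "x \<beta> = \<sigma> p (x \<alpha>)"
      using \<sigma>_B[OF x_B] x_bij unfolding bij_betw_def by (metis imageE)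
    then show ?thesis unfolding g_def by (rule theI) (simp add: x_inj \<open>x \<beta> = \<sigma> p (x \<alpha>)\<close>[symmetric])
  qed
  have g_invol: "g p (g p \<alpha>) = \<alpha>" for p \<alpha>
    using cluster_reflection.involution[OF reflection x_A, of p \<alpha>] by (simp add: g x_inj[symmetric])
  have g_bij: "bij (g p)" for p
    by (rule bij_betw_byWitness[of _ "g p"]) (auto simp: g_invol)
  have expansion: "\<exists>f. x \<alpha> = laurent_eval (?y m) (?y (m + 1)) f \<and>
      x (g p \<alpha>) = laurent_eval (?y (2 * p - m)) (?y (2 * p - m - 1)) f" for \<alpha> m p
  proof -
    interpret cluster_reflection b c "\<sigma> p" p by (rule reflection)
    obtain f where f: "x \<alpha> = laurent_eval (?y m) (?y (m + 1)) f"
      using x_pos[of \<alpha>] unfolding positive_element_def by blast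
    show ?thesis
      using f reflect_laurent_expansion[OF x_A f] by (auto simp: g algebra_simps)
  qed
  have denominator: "\<exists>N. coeff (coeff N 0) 0 = 1 \<and> x \<alpha> = to_fract N / (Y1 powi fst \<alpha> * Y2 powi snd \<alpha>)" for \<alpha>
    using x_iff[of "x \<alpha>" \<alpha>] by (simp add: has_denominator_vector_def)
  have combination: "\<exists>S n. finite S \<and> (\<forall>\<gamma>\<in>S. n \<gamma> \<noteq> 0) \<and> z = (\<Sum>\<gamma>\<in>S. of_int (n \<gamma>) * x \<gamma>)"
    if "z \<in> ?A" for z
  proof -
    let ?n = "int_scale.representation B z"
    let ?S = "{\<gamma>. ?n (x \<gamma>) \<noteq> 0}"
    have bij: "bij_betw x ?S {w. ?n w \<noteq> 0}"
    proof (rule bij_betw_imageI)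
      show "inj_on x ?S" by (simp add: inj_on_def x_inj)
      have "w \<in> x ` ?S" if "?n w \<noteq> 0" for w
      proof -
        have "w \<in> range x"
          using int_scale.representation_ne_zero[OF that] x_bij by (simp add: bij_betw_def)
        then show ?thesis using that by auto
      qed
      then show "x ` ?S = {w. ?n w \<noteq> 0}" by auto
    qed
    have "z = (\<Sum>w | ?n w \<noteq> 0. of_int (?n w) * w)"
      using int_scale.sum_nonzero_representation_eq[OF indep, of z] that
      by (simp add: int_scale_def span_B)
    also have "\<dots> = (\<Sum>\<gamma>\<in>?S. of_int (?n (x \<gamma>)) * x \<gamma>)"
      using bij by (rule sum.reindex_bij_betw[symmetric])
    finally have "z = (\<Sum>\<gamma>\<in>?S. of_int (?n (x \<gamma>)) * x \<gamma>)" .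
    moreover have "finite ?S"
      using bij_betw_finite[OF bij] int_scale.finite_representation by blast
    ultimately show ?thesis by (intro exI[of _ ?S] exI[of _ "\<lambda>\<gamma>. ?n (x \<gamma>)"]) auto
  qed
  note mem = cluster_algebra_var cluster_algebra_power cluster_algebra_mult
  have Y_A: "Y1 \<in> ?A" "Y2 \<in> ?A"
    using cluster_algebra_var[of b c 1] cluster_algebra_var[of b c 2]
    by (simp_all add: cluster_var_1 cluster_var_2)
  have g_1: "g 1 (a1, a2) = (a1, int c * max a1 0 - a2)" for a1 a2
  proof (rule exchange_chart.reflected_denominator_vector[OF exchange_chart_Y1[OF assms(1,2)]])
    show "\<exists>f. x \<beta> = laurent_eval Y1 Y2 f \<and> x (g 1 \<beta>) = laurent_eval Y1 (?y 0) f" for \<beta>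
      using expansion[of \<beta> 1 1] by (simp add: cluster_var_1 cluster_var_2)
    show "\<exists>h. x \<beta> = laurent_eval Y2 (?y 3) h" for \<beta>
      using expansion[of \<beta> 2 1] by (auto simp: cluster_var_2)
    show "inj (g 1)" using g_bij by (rule bij_is_inj)
  qed (intro combination denominator mem Y_A)+
  \<comment> \<open>For \<open>p = 2\<close> the roles of \<open>y\<^sub>1\<close> and \<open>y\<^sub>2\<close> are interchanged, hence the swapped coordinates.\<close>
  have "(prod.swap \<circ> g 2 \<circ> prod.swap) (a2, a1) = (a2, int b * max a2 0 - a1)" for a1 a2
  proof (rule exchange_chart.reflected_denominator_vector[OF exchange_chart_Y2[OF assms(1,2)],
      where x = "x \<circ> prod.swap"])
    show "\<exists>N. coeff (coeff N 0) 0 = 1 \<and>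
        (x \<circ> prod.swap) \<beta> = to_fract N / (Y2 powi fst \<beta> * Y1 powi snd \<beta>)" for \<beta>
      using denominator[of "prod.swap \<beta>"] by (simp add: mult.commute)
    show "\<exists>f. (x \<circ> prod.swap) \<beta> = laurent_eval Y2 Y1 f \<and>
        (x \<circ> prod.swap) ((prod.swap \<circ> g 2 \<circ> prod.swap) \<beta>) = laurent_eval Y2 (?y 3) f" for \<beta>
    proof -
      obtain f where f: "x (prod.swap \<beta>) = laurent_eval Y1 Y2 f"
        "x (g 2 (prod.swap \<beta>)) = laurent_eval (?y 3) Y2 f"
        using expansion[of "prod.swap \<beta>" 1 2] by (auto simp: cluster_var_1 cluster_var_2)
      show ?thesis
        by (rule exI[of _ "Poly_Mapping.map_key prod.swap f"]) (simp add: f laurent_eval_swap)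
    qed
    show "\<exists>h. (x \<circ> prod.swap) \<beta> = laurent_eval Y1 (?y 0) h" for \<beta>
    proof -
      obtain f where "x (prod.swap \<beta>) = laurent_eval (?y 0) Y1 f"
        using expansion[of "prod.swap \<beta>" 0 1] by (auto simp: cluster_var_1)
      then show ?thesis
        by (intro exI[of _ "Poly_Mapping.map_key prod.swap f"]) (simp add: laurent_eval_swap)
    qed
    show "inj (prod.swap \<circ> g 2 \<circ> prod.swap)"
      using g_bij[of 2] by (auto intro!: inj_compose simp: bij_is_inj)
    show "\<exists>S n. finite S \<and> (\<forall>\<gamma>\<in>S. n \<gamma> \<noteq> 0) \<and>
        ?y 0 ^ nat a1 * Y2 ^ nat (- a1) * (?y 3 ^ nat a2 * Y1 ^ nat (- a2)) =
        (\<Sum>\<gamma>\<in>S. of_int (n \<gamma>) * (x \<circ> prod.swap) \<gamma>)" for a1 a2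
    proof -
      have "?y 0 ^ nat a1 * Y2 ^ nat (- a1) * (?y 3 ^ nat a2 * Y1 ^ nat (- a2)) \<in> ?A"
        by (intro mem Y_A)
      from combination[OF this] obtain S n where S: "finite S" "\<forall>\<gamma>\<in>S. n \<gamma> \<noteq> 0"
        "?y 0 ^ nat a1 * Y2 ^ nat (- a1) * (?y 3 ^ nat a2 * Y1 ^ nat (- a2)) =
        (\<Sum>\<gamma>\<in>S. of_int (n \<gamma>) * x \<gamma>)" by (elim exE conjE)
      have "(\<Sum>\<gamma>\<in>S. of_int (n \<gamma>) * x \<gamma>) =
          (\<Sum>\<gamma>\<in>prod.swap ` S. of_int ((n \<circ> prod.swap) \<gamma>) * (x \<circ> prod.swap) \<gamma>)"
        by (simp add: sum.reindex)
      then show ?thesis using S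
        by (intro exI[of _ "prod.swap ` S"] exI[of _ "n \<circ> prod.swap"]) auto
    qed
  qed
  then have g_2: "g 2 (a1, a2) = (int b * max a2 0 - a1, a2)" for a1 a2
    by (metis comp_apply swap_simp swap_swap)
  \<comment> \<open>Conjugating the reflection of the index line at \<open>p\<close> by the one at \<open>r\<close> gives the one at \<open>2 r - p\<close>. So
    all reflections are generated by those at \<open>1\<close> and \<open>2\<close>.\<close>
  have g_conj: "g (2 * r - p) = g r \<circ> g p \<circ> g r" for r p
  proof
    fix \<alpha>
    have "(\<sigma> r \<circ> \<sigma> p \<circ> \<sigma> r) (x \<alpha>) = \<sigma> (2 * r - p) (x \<alpha>)"
      by (rule ring_automorphism_on_eqI[OF ring_automorphism_on_compose[OF
          ring_automorphism_on_compose[OF assms(6) assms(6)] assms(6)] assms(6) _ x_A])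
        (simp add: assms(7) algebra_simps)
    then show "g (2 * r - p) \<alpha> = (g r \<circ> g p \<circ> g r) \<alpha>"
      by (simp add: g x_inj[symmetric])
  qed
  have pl_conj: "piecewise_linear (g (2 * r - p))"
    if "piecewise_linear (g r)" "piecewise_linear (g p)" for r p
    unfolding g_conj using that by (intro piecewise_linear_compose)
  have "piecewise_linear (g p) \<and> piecewise_linear (g (p + 1))" for p
  proof (induction p rule: int_induct[where k = 1])
    case base
    have "g 1 = (\<lambda>(a1, a2). (a1, int c * max a1 0 - a2))"
      "g 2 = (\<lambda>(a1, a2). (int b * max a2 0 - a1, a2))"
      using g_1 g_2 by auto
    then show ?case using piecewise_linear_reflections by simp
  next
    case (step1 i)
    then show ?case using pl_conj[of "i + 1" i] by (simp add: add.commute)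
  next
    case (step2 i)
    then show ?case using pl_conj[of i "i + 1"] by simp
  qed
  then show ?thesis using g g_bij g_1 g_2 by blast
qed

end
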